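(* Let $\mathbb{B}$ be a Boolean algebra such that $2^{\mathrm{cf}(\mathrm{t}(\mathbb{B}))}<\mathrm{t}(\mathbb{B})$. Then there is an ideal $I$ of $\mathbb{B}$ such that $\mathrm{Depth}(\mathbb{B}/I)=\mathrm{t}(\mathbb{B})$.
   Context: A sequence $\langle b_\alpha:\alpha<\xi\rangle$ of elements of a Boolean algebra $\mathbb{B}$ is (algebraically) free if for all finite $F,G\subseteq\xi$ with $\max(F)<\min(G)$ we have $\bigwedge_{\alpha\in F}b_\alpha\wedge\bigwedge_{\alpha\in G}(-b_\alpha)\neq 0$. The tightness $\mathrm{t}(\mathbb{B})$ is the supremum of $|\alpha|$ over all ordinals $\alpha$ such that there is a free sequence of length $\alpha$ in $\mathbb{B}$. $\mathrm{Depth}(\mathbb{B})$ is the supremum of the cardinalities of well-ordered (by the Boolean order) strictly increasing chains in $\mathbb{B}$. *)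

theory Defs
  imports Main
begin

unbundle cardinal_syntax

text \<open>
  Cardinals are the cardinal order relations of the library, so they are determined only up to
  \<open>=o\<close>; ordinals are well-order relations. A Boolean algebra is a type of class
  \<open>boolean_algebra\<close> (infinite, complete or nontrivial is not required).
\<close>

section \<open>Suprema of cardinals and cofinality\<close>

definition card_Sup :: "'a rel set \<Rightarrow> 'a rel" where
  "card_Sup R = (SOME k. Card_order k \<and> (\<forall>r\<in>R. r \<le>o k) \<and>
     (\<forall>k'::'a rel. Card_order k' \<and> (\<forall>r\<in>R. r \<le>o k') \<longrightarrow> k \<le>o k'))"

lemma card_Sup:
  fixes R :: "'a rel set"
  assumes "\<forall>r\<in>R. Card_order r"
  shows "Card_order (card_Sup R)"
    and "\<forall>r\<in>R. r \<le>o card_Sup R"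
    and "\<And>k'::'a rel. Card_order k' \<Longrightarrow> \<forall>r\<in>R. r \<le>o k' \<Longrightarrow> card_Sup R \<le>o k'"
proof -
  let ?K = "{k::'a rel. Card_order k \<and> (\<forall>r\<in>R. r \<le>o k)}"
  have "|UNIV::'a set| \<in> ?K"
  proof -
    have "r \<le>o |UNIV::'a set|" if "r \<in> R" for r
    proof -
      have "r =o |Field r|" using assms that card_of_Field_ordIso ordIso_symmetric by blast
      moreover have "|Field r| \<le>o |UNIV::'a set|" by (rule card_of_mono1) simp
      ultimately show ?thesis by (rule ordIso_ordLeq_trans)
    qed
    then show ?thesis by (simp add: card_of_Card_order)
  qed
  then obtain k where "k \<in> ?K" "\<forall>k'\<in>?K. k \<le>o k'"
    using exists_minim_Card_order[of ?K] by blast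
  then have "\<exists>k::'a rel. Card_order k \<and> (\<forall>r\<in>R. r \<le>o k) \<and>
      (\<forall>k'::'a rel. Card_order k' \<and> (\<forall>r\<in>R. r \<le>o k') \<longrightarrow> k \<le>o k')" by blast
  from someI_ex[OF this, folded card_Sup_def]
  show "Card_order (card_Sup R)" "\<forall>r\<in>R. r \<le>o card_Sup R"
    "\<And>k'::'a rel. Card_order k' \<Longrightarrow> \<forall>r\<in>R. r \<le>o k' \<Longrightarrow> card_Sup R \<le>o k'" by blast+
qed

text \<open>
  The library's \<open>cofinal\<close> asks for strict bounds and so has no instance when the order has a
  greatest element; the weak bound below also covers that case (cofinality 1). For orders
  without greatest element both give the same cofinality.
\<close>

definition unbounded_in :: "'a set \<Rightarrow> 'a rel \<Rightarrow> bool" where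
  "unbounded_in A r \<longleftrightarrow> A \<subseteq> Field r \<and> (\<forall>a\<in>Field r. \<exists>b\<in>A. (a, b) \<in> r)"

definition cofinality :: "'a rel \<Rightarrow> 'a rel" where
  "cofinality r = |SOME A. unbounded_in A r \<and> (\<forall>A'. unbounded_in A' r \<longrightarrow> |A| \<le>o |A'| )|"

lemma cofinality:
  assumes "Well_order r"
  shows "\<exists>A. unbounded_in A r \<and> cofinality r = |A|"
    and "unbounded_in A' r \<Longrightarrow> cofinality r \<le>o |A'|"
proof -
  let ?K = "{|A| |A. unbounded_in A r}"
  have "refl_on (Field r) r"
    using assms by (simp add: order_on_defs)
  then have "unbounded_in (Field r) r"
    by (auto simp: unbounded_in_def refl_on_def)
  then have "?K \<noteq> {}" by blast
  moreover have "\<forall>k\<in>?K. Card_order k" by (auto intro: card_of_Card_order)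
  ultimately obtain k where "k \<in> ?K" "\<forall>k'\<in>?K. k \<le>o k'"
    using exists_minim_Card_order[of ?K] by blast
  then have "\<exists>A. unbounded_in A r \<and> (\<forall>A'. unbounded_in A' r \<longrightarrow> |A| \<le>o |A'| )"
    by blast
  from someI_ex[OF this]
  show "\<exists>A. unbounded_in A r \<and> cofinality r = |A|"
    and "unbounded_in A' r \<Longrightarrow> cofinality r \<le>o |A'|"
    unfolding cofinality_def by blast+
qed

section \<open>Free sequences and tightness\<close>

text \<open>
  A sequence indexed by the ordinal (well-order) \<open>r\<close>. The condition \<open>max F < min G\<close> is read as
  ``every element of \<open>F\<close> is below every element of \<open>G\<close>'', so that \<open>F\<close> and \<open>G\<close> may be empty; the
  inserted \<open>top\<close> is the value of the empty meet.
\<close>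

definition free_sequence :: "'i rel \<Rightarrow> ('i \<Rightarrow> 'a::boolean_algebra) \<Rightarrow> bool" where
  "free_sequence r b \<longleftrightarrow> Well_order r \<and>
     (\<forall>F G. finite F \<and> finite G \<and> F \<subseteq> Field r \<and> G \<subseteq> Field r \<and>
        (\<forall>\<alpha>\<in>F. \<forall>\<beta>\<in>G. (\<alpha>, \<beta>) \<in> r \<and> \<alpha> \<noteq> \<beta>) \<longrightarrow>
        \<Sqinter>\<^sub>f\<^sub>i\<^sub>n (insert top (b ` F \<union> (\<lambda>\<beta>. - b \<beta>) ` G)) \<noteq> bot)"

text \<open>
  Only lengths that are well-orders on the type of the algebra itself are taken into account.
  This is no restriction, as the members of a free sequence are pairwise distinct: see
  \<open>free_sequence_le_tightness\<close>.
\<close>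

definition tightness :: "'a::boolean_algebra rel" where
  "tightness = card_Sup {|Field r| | r::'a rel. \<exists>b::'a \<Rightarrow> 'a. free_sequence r b}"

lemma free_sequence_inj_on:
  assumes "free_sequence r b"
  shows "inj_on b (Field r)"
proof -
  have ne: "b x \<noteq> b y" if "(x, y) \<in> r" "x \<noteq> y" for x y
  proof -
    have "x \<in> Field r" "y \<in> Field r" using that by (auto simp: Field_def)
    then have "\<Sqinter>\<^sub>f\<^sub>i\<^sub>n (insert top (b ` {x} \<union> (\<lambda>\<beta>. - b \<beta>) ` {y})) \<noteq> bot"
      using assms[unfolded free_sequence_def, THEN conjunct2, rule_format, of "{x}" "{y}"] that
      by simp
    then show ?thesis by auto
  qed
  have "total_on (Field r) r"
    using assms by (simp add: free_sequence_def order_on_defs)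
  then show ?thesis
    unfolding total_on_def using ne by (intro inj_onI) metis
qed

lemma free_sequence_le_tightness:
  fixes r :: "'i rel" and b :: "'i \<Rightarrow> 'a::boolean_algebra"
  assumes "free_sequence r b"
  shows "|Field r| \<le>o (tightness :: 'a rel)"
proof -
  have inj: "inj_on b (Field r)" by (rule free_sequence_inj_on[OF assms])
  have W: "Well_order r" using assms by (simp add: free_sequence_def)
  define s where "s = dir_image r b"
  have F: "Field s = b ` Field r" unfolding s_def by (rule dir_image_Field)
  have Ws: "Well_order s" unfolding s_def by (rule Well_order_dir_image[OF W inj])
  define g where "g = inv_into (Field r) b"
  have gr: "g y \<in> Field r" "b (g y) = y" if "y \<in> Field s" for y
    using that unfolding F g_def by (auto intro: inv_into_into f_inv_into_f)
  have sr: "(g x, g y) \<in> r" if xy: "(x, y) \<in> s" for x y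
  proof -
    obtain u v where uv: "x = b u" "y = b v" "(u, v) \<in> r"
      using xy unfolding s_def dir_image_def by auto
    then have "g x = u" "g y = v"
      unfolding g_def by (simp_all add: inv_into_f_f[OF inj] FieldI1 FieldI2)
    with uv show ?thesis by simp
  qed
  have "free_sequence s id"
    unfolding free_sequence_def
  proof (intro conjI allI impI)
    fix A B
    assume *: "finite A \<and> finite B \<and> A \<subseteq> Field s \<and> B \<subseteq> Field s \<and>
      (\<forall>\<alpha>\<in>A. \<forall>\<beta>\<in>B. (\<alpha>, \<beta>) \<in> s \<and> \<alpha> \<noteq> \<beta>)"
    have 1: "b ` g ` A = id ` A" using * gr by (force simp: image_image)
    have 2: "(\<lambda>\<beta>. - b \<beta>) ` g ` B = (\<lambda>\<beta>. - id \<beta>) ` B"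
      using * gr by (force simp: image_image)
    have "\<forall>\<alpha>\<in>g ` A. \<forall>\<beta>\<in>g ` B. (\<alpha>, \<beta>) \<in> r \<and> \<alpha> \<noteq> \<beta>"
    proof clarify
      fix x y assume xy: "x \<in> A" "y \<in> B"
      then have "(x, y) \<in> s" "x \<noteq> y" using * by auto
      moreover have "x \<in> Field s" "y \<in> Field s" using xy * by auto
      ultimately show "(g x, g y) \<in> r \<and> g x \<noteq> g y" using sr gr(2) by metis
    qed
    moreover have "finite (g ` A)" "finite (g ` B)" "g ` A \<subseteq> Field r" "g ` B \<subseteq> Field r"
      using * gr by auto
    ultimately have "\<Sqinter>\<^sub>f\<^sub>i\<^sub>n (insert top (b ` g ` A \<union> (\<lambda>\<beta>. - b \<beta>) ` g ` B)) \<noteq> bot"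
      using assms unfolding free_sequence_def by blast
    then show "\<Sqinter>\<^sub>f\<^sub>i\<^sub>n (insert top (id ` A \<union> (\<lambda>\<beta>. - id \<beta>) ` B)) \<noteq> bot"
      unfolding 1 2 .
  qed (rule Ws)
  then have "|Field s| \<le>o (tightness :: 'a rel)"
    unfolding tightness_def
    by (intro bspec[OF card_Sup(2)]) (auto intro: card_of_Card_order)
  moreover have "bij_betw b (Field r) (Field s)"
    using inj F by (simp add: bij_betw_def)
  then have "|Field r| =o |Field s|" by (rule card_of_ordIsoI)
  ultimately show ?thesis by (metis ordIso_ordLeq_trans)
qed

section \<open>Depth\<close>

text \<open>
  The depth depends only on the order. It is defined for a reflexive partial order \<open>r\<close>, given as a
  relation, so that it applies to the quotients below, whose carrier is not a type.
\<close>

definition Depth :: "'a rel \<Rightarrow> 'a rel" where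
  "Depth r = card_Sup {|C| | C. C \<subseteq> Field r \<and> well_order_on C (Restr r C)}"

section \<open>Ideals and quotients\<close>

definition ba_ideal :: "'a::boolean_algebra set \<Rightarrow> bool" where
  "ba_ideal I \<longleftrightarrow> bot \<in> I \<and> (\<forall>a\<in>I. \<forall>b. b \<le> a \<longrightarrow> b \<in> I) \<and> (\<forall>a\<in>I. \<forall>b\<in>I. sup a b \<in> I)"

definition ideal_equiv :: "'a::boolean_algebra set \<Rightarrow> 'a rel" where
  "ideal_equiv I = {(a, b). sup (a - b) (b - a) \<in> I}"

text \<open>
  The Boolean order of the quotient algebra with carrier \<open>UNIV // ideal_equiv I\<close>: for classes
  \<open>[a]\<close>, \<open>[b]\<close> one has \<open>[a] \<le> [b]\<close> iff \<open>[a] \<and> [b] = [a]\<close>, where \<open>[a] \<and> [b] = [inf a b]\<close>.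
\<close>

definition quotient_order :: "'a::boolean_algebra set \<Rightarrow> 'a set rel" where
  "quotient_order I = {(ideal_equiv I `` {a}, ideal_equiv I `` {b}) | a b.
     ideal_equiv I `` {inf a b} = ideal_equiv I `` {a}}"

lemma diff_le_sup_diff: "a - c \<le> sup (a - b) (b - c)" for a b c :: "'a::boolean_algebra"
proof -
  have "a - c = inf (inf a (- c)) (sup b (- b))" by (simp add: diff_eq)
  also have "\<dots> = sup (inf (inf a (- c)) b) (inf (inf a (- c)) (- b))"
    by (rule inf_sup_distrib1)
  also have "\<dots> \<le> sup (a - b) (b - c)"
  proof (rule sup_least)
    have "inf (inf a (- c)) b \<le> b - c" by (simp add: diff_eq le_infI1)
    then show "inf (inf a (- c)) b \<le> sup (a - b) (b - c)" by (rule le_supI2)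
    have "inf (inf a (- c)) (- b) \<le> a - b" by (simp add: diff_eq le_infI1)
    then show "inf (inf a (- c)) (- b) \<le> sup (a - b) (b - c)" by (rule le_supI1)
  qed
  finally show ?thesis .
qed

lemma ideal_equiv_iff:
  assumes "ba_ideal I"
  shows "(a, b) \<in> ideal_equiv I \<longleftrightarrow> a - b \<in> I \<and> b - a \<in> I"
proof -
  have "a - b \<le> sup (a - b) (b - a)" "b - a \<le> sup (a - b) (b - a)" by simp_all
  then show ?thesis
    using assms unfolding ba_ideal_def ideal_equiv_def mem_Collect_eq prod.case by metis
qed

lemma ideal_diff_trans:
  assumes "ba_ideal I" "a - b \<in> I" "b - c \<in> I"
  shows "a - c \<in> I"
  using assms diff_le_sup_diff[of a c b] unfolding ba_ideal_def by metis

lemma equiv_ideal_equiv: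
  assumes "ba_ideal I"
  shows "equiv UNIV (ideal_equiv I)"
proof (rule equivI)
  show "refl (ideal_equiv I)"
    using assms by (auto simp: refl_on_def ideal_equiv_iff ba_ideal_def diff_eq)
  show "sym (ideal_equiv I)"
    using assms by (auto simp: sym_def ideal_equiv_iff)
  show "trans (ideal_equiv I)"
    using assms by (auto simp: trans_def ideal_equiv_iff intro: ideal_diff_trans)
qed simp_all

lemma quotient_order_iff:
  assumes I: "ba_ideal I"
  shows "(ideal_equiv I `` {a}, ideal_equiv I `` {b}) \<in> quotient_order I \<longleftrightarrow> a - b \<in> I"
proof -
  note eq = eq_equiv_class_iff[OF equiv_ideal_equiv[OF I] UNIV_I UNIV_I] ideal_equiv_iff[OF I]
  have *: "ideal_equiv I `` {inf x y} = ideal_equiv I `` {x} \<longleftrightarrow> x - y \<in> I" for x y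
  proof -
    have e: "inf x y - x = inf y (inf x (- x))"
      by (simp only: diff_eq inf.assoc inf.left_commute inf.commute)
    have "inf y (inf x (- x)) \<in> I" using I by (simp add: ba_ideal_def)
    then have "inf x y - x \<in> I" unfolding e .
    moreover have "x - inf x y = x - y"
      by (simp add: diff_eq inf_sup_distrib1)
    ultimately show ?thesis unfolding eq by metis
  qed
  show ?thesis
  proof
    assume "(ideal_equiv I `` {a}, ideal_equiv I `` {b}) \<in> quotient_order I"
    then obtain x y where xy: "ideal_equiv I `` {a} = ideal_equiv I `` {x}"
      "ideal_equiv I `` {b} = ideal_equiv I `` {y}" "x - y \<in> I"
      unfolding quotient_order_def * by auto
    then have "a - x \<in> I" "y - b \<in> I" unfolding eq by simp_all
    with xy(3) show "a - b \<in> I" using ideal_diff_trans[OF I] by metis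
  next
    assume "a - b \<in> I"
    then show "(ideal_equiv I `` {a}, ideal_equiv I `` {b}) \<in> quotient_order I"
      unfolding quotient_order_def * by auto
  qed
qed

lemma partial_order_quotient_order:
  assumes I: "ba_ideal I"
  shows "partial_order_on (UNIV // ideal_equiv I) (quotient_order I)"
proof -
  note E = equiv_ideal_equiv[OF I]
  note eq = eq_equiv_class_iff[OF E UNIV_I UNIV_I] ideal_equiv_iff[OF I]
  let ?Q = "UNIV // ideal_equiv I" and ?r = "quotient_order I"
  have sub: "?r \<subseteq> ?Q \<times> ?Q"
    unfolding quotient_order_def by (auto intro: quotientI)
  have [simp]: "a - a \<in> I" for a using I by (simp add: ba_ideal_def diff_eq)
  have "refl_on ?Q ?r"
    unfolding refl_on_def by (auto elim!: quotientE simp: quotient_order_iff[OF I])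
  moreover have "trans ?r"
  proof (rule transI)
    fix X Y Z assume *: "(X, Y) \<in> ?r" "(Y, Z) \<in> ?r"
    then have "X \<in> ?Q" "Y \<in> ?Q" "Z \<in> ?Q" using sub by auto
    with * show "(X, Z) \<in> ?r"
      by (auto elim!: quotientE simp: quotient_order_iff[OF I]) (blast intro: ideal_diff_trans[OF I])
  qed
  moreover have "antisym ?r"
  proof (rule antisymI)
    fix X Y assume *: "(X, Y) \<in> ?r" "(Y, X) \<in> ?r"
    then have "X \<in> ?Q" "Y \<in> ?Q" using sub by auto
    then obtain a b where "X = ideal_equiv I `` {a}" "Y = ideal_equiv I `` {b}"
      by (auto elim!: quotientE)
    with * show "X = Y" by (simp add: quotient_order_iff[OF I] eq)
  qed
  ultimately show ?thesis using sub by (simp add: order_on_defs)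
qed

end

(*
  Let t be the tightness. A free sequence gives ultrafilters x_a with b_c in x_a iff c <= a, and on
  the closure of these points the b_c become a strictly decreasing chain; conversely a chain in a
  quotient lifts to a free sequence. So if t is the length of a free sequence, the ideal of its
  points works.

  Otherwise t is a singular limit cardinal. Let K be unbounded in t, |K| = cf t, let c be the
  cardinal 2^|K|++, and take for each j in K a free sequence b_j on a lexicographic product of c
  with a cardinal w_j, where the w_j are unbounded in t. It suffices to find an interval
  [l_j, u_j) of c for each j and w_j many points in block l_j of the j-th sequence that lie
  outside all e_i = b_i(l_i,0) - b_i(u_i,0) with i ~= j: on these points e_j isolates the j-th
  family, and the e_j - b_j(l_j,a) form a chain. As there are only c many choices of intervals, a
  diagonal argument reduces this to a single point per block, where it is a reflection argument:
  choose the intervals recursively inside a set M of size 2^|K|+ that is closed under |K|-sequences,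
  keeping the points of a fixed block d outside M unsplit.
*)
theory Submission
  imports Defs
begin

section \<open>Ultrafilters\<close>

text \<open>Membership in \<open>U\<close> is a Boolean homomorphism to the two-element algebra;
  properness and upward closure follow from the two equivalences.\<close>

definition ultrafilter :: "'a::boolean_algebra set \<Rightarrow> bool" where
  "ultrafilter U \<longleftrightarrow> (\<forall>a b. inf a b \<in> U \<longleftrightarrow> a \<in> U \<and> b \<in> U) \<and> (\<forall>a. - a \<in> U \<longleftrightarrow> a \<notin> U)"

lemma ultrafilter_inf [simp]: "ultrafilter U \<Longrightarrow> inf a b \<in> U \<longleftrightarrow> a \<in> U \<and> b \<in> U"
  and ultrafilter_uminus [simp]: "ultrafilter U \<Longrightarrow> - a \<in> U \<longleftrightarrow> a \<notin> U"
  by (simp_all add: ultrafilter_def)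

lemma ultrafilter_diff [simp]: "ultrafilter U \<Longrightarrow> a - b \<in> U \<longleftrightarrow> a \<in> U \<and> b \<notin> U"
  by (simp add: diff_eq)

lemma ultrafilter_sup [simp]:
  assumes "ultrafilter U"
  shows "sup a b \<in> U \<longleftrightarrow> a \<in> U \<or> b \<in> U"
proof -
  have "sup a b = - inf (- a) (- b)" by simp
  then show ?thesis using assms by (simp del: compl_inf)
qed

lemma ultrafilter_bot [simp]:
  assumes "ultrafilter U"
  shows "bot \<notin> U"
proof -
  have "bot \<in> U \<longleftrightarrow> bot \<in> U \<and> - bot \<in> U"
    using ultrafilter_inf[OF assms, of bot "- bot"] by simp
  then show ?thesis using ultrafilter_uminus[OF assms, of bot] by blast
qed

lemma ultrafilter_top [simp]: "ultrafilter U \<Longrightarrow> top \<in> U"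
  using ultrafilter_uminus[of U bot] by simp

lemma ultrafilter_mono: "ultrafilter U \<Longrightarrow> a \<le> b \<Longrightarrow> a \<in> U \<Longrightarrow> b \<in> U"
  by (metis inf.absorb_iff1 ultrafilter_inf)

abbreviation meet :: "'a::boolean_algebra set \<Rightarrow> 'a" where
  "meet F \<equiv> \<Sqinter>\<^sub>f\<^sub>i\<^sub>n (insert top F)"

lemma meet_insert: "finite F \<Longrightarrow> meet (insert a F) = inf a (meet F)"
  by (simp add: insert_commute[of top])

lemma meet_Un: "finite F \<Longrightarrow> finite G \<Longrightarrow> meet (F \<union> G) = inf (meet F) (meet G)"
  using Inf_fin.union[of "insert top F" "insert top G"] by simp

lemma meet_antimono: "finite G \<Longrightarrow> F \<subseteq> G \<Longrightarrow> meet G \<le> meet F"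
  by (rule Inf_fin.subset_imp) auto

lemma meet_in_ultrafilter:
  assumes "ultrafilter U" "finite F"
  shows "meet F \<in> U \<longleftrightarrow> F \<subseteq> U"
  using assms(2) by induction (use assms(1) in \<open>auto simp: meet_insert simp del: Inf_fin.insert\<close>)

definition fip :: "'a::boolean_algebra set \<Rightarrow> bool" where
  "fip S \<longleftrightarrow> (\<forall>F. finite F \<longrightarrow> F \<subseteq> S \<longrightarrow> meet F \<noteq> bot)"

lemma not_fip_insertE:
  assumes "\<not> fip (insert a S)"
  obtains F where "finite F" "F \<subseteq> S" "meet F \<le> - a"
proof -
  obtain F where F: "finite F" "F \<subseteq> insert a S" "meet F = bot"
    using assms unfolding fip_def by blast
  have "inf a (meet (F - {a})) = meet (insert a F)"
    using F(1) by (subst meet_insert[symmetric]) auto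
  also have "\<dots> \<le> bot" using meet_antimono[of "insert a F" F] F by auto
  finally have "meet (F - {a}) \<le> - a"
    by (metis inf.commute inf_shunt bot_unique)
  then show thesis using that[of "F - {a}"] F by auto
qed

text \<open>Zorn's lemma gives a maximal family with the finite intersection property; it contains
  everything above one of its finite meets, and hence exactly one of \<open>a\<close> and
  \<open>- a\<close>.\<close>

theorem ultrafilter_exists:
  assumes "fip S"
  shows "\<exists>U. ultrafilter U \<and> S \<subseteq> U"
proof -
  let ?A = "{T. S \<subseteq> T \<and> fip T}"
  have "\<exists>U\<in>?A. \<forall>X\<in>?A. U \<subseteq> X \<longrightarrow> X = U"
  proof (rule subset_Zorn_nonempty)
    show "?A \<noteq> {}" using assms by blast
    fix C assume C: "C \<noteq> {}" "subset.chain ?A C"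
    have "meet F \<noteq> bot" if F: "finite F" "F \<subseteq> \<Union>C" for F
    proof -
      obtain T where "T \<in> C" "F \<subseteq> T"
        using finite_subset_Union_chain[OF F C] by blast
      moreover have "fip T" using C(2) \<open>T \<in> C\<close> unfolding subset.chain_def by blast
      ultimately show ?thesis using F(1) unfolding fip_def by blast
    qed
    then show "\<Union>C \<in> ?A" using C unfolding fip_def subset.chain_def by blast
  qed
  then obtain U where "U \<in> ?A" and max': "\<forall>X\<in>?A. U \<subseteq> X \<longrightarrow> X = U" by (rule bexE)
  then have U: "S \<subseteq> U" "fip U" by simp_all
  have max: "X = U" if "S \<subseteq> X" "fip X" "U \<subseteq> X" for X
    using max' that by simp
  \<comment> \<open>By maximality, a missing \<open>a\<close> yields a finite \<open>G\<close> in
    \<open>U\<close> with meet below \<open>- a\<close>; then \<open>F \<union> G\<close> has meet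
    \<open>bot\<close>.\<close>
  have mem: "a \<in> U" if "finite F" "F \<subseteq> U" "meet F \<le> a" for a F
  proof (rule ccontr)
    assume "a \<notin> U"
    then have "\<not> fip (insert a U)" using max[of "insert a U"] U(1) by blast
    then obtain G where G: "finite G" "G \<subseteq> U" "meet G \<le> - a" using not_fip_insertE by metis
    have "meet (F \<union> G) \<le> inf a (- a)"
      unfolding meet_Un[OF that(1) G(1)] by (rule inf_mono[OF that(3) G(3)])
    then have "meet (F \<union> G) = bot" by (simp add: bot_unique)
    moreover have "finite (F \<union> G)" "F \<union> G \<subseteq> U" using that G by auto
    ultimately show False using U(2) unfolding fip_def by blast
  qed
  have inf: "inf a b \<in> U \<longleftrightarrow> a \<in> U \<and> b \<in> U" for a b
  proof
    assume "inf a b \<in> U"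
    then show "a \<in> U \<and> b \<in> U" by (auto intro: mem[of "{inf a b}"])
  next
    assume "a \<in> U \<and> b \<in> U"
    then show "inf a b \<in> U" by (intro mem[of "{a, b}"]) (auto simp: inf_commute)
  qed
  have bot: "bot \<notin> U"
  proof
    assume "bot \<in> U"
    then have "meet {bot :: 'a} \<noteq> bot" using U(2) unfolding fip_def by blast
    then show False by simp
  qed
  have "- a \<in> U \<longleftrightarrow> a \<notin> U" for a
  proof
    assume "- a \<in> U"
    then show "a \<notin> U" using bot inf[of a "- a"] by auto
  next
    assume "a \<notin> U"
    then have "\<not> fip (insert a U)" using max[of "insert a U"] U(1) by blast
    then obtain G where "finite G" "G \<subseteq> U" "meet G \<le> - a" using not_fip_insertE by metis
    then show "- a \<in> U" by (rule mem)
  qed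
  with inf have "ultrafilter U" unfolding ultrafilter_def by blast
  with U(1) show ?thesis by blast
qed

text \<open>A finite meet of complements of members of \<open>I\<close> is again such a complement,
  so it cannot lie below \<open>- a\<close>: otherwise \<open>a\<close> would belong to
  \<open>I\<close>.\<close>

lemma ultrafilter_exists_avoiding:
  assumes I: "ba_ideal I" and a: "a \<notin> I"
  shows "\<exists>U. ultrafilter U \<and> a \<in> U \<and> U \<inter> I = {}"
proof -
  have "- meet F \<in> I" if "finite F" "F \<subseteq> uminus ` I" for F
    using that
  proof induction
    case empty
    then show ?case using I by (simp add: ba_ideal_def)
  next
    case (insert x F)
    then have "sup (- x) (- meet F) \<in> I"
      using I unfolding ba_ideal_def by auto
    then show ?case using insert.hyps by (simp only: meet_insert compl_inf)
  qed
  then have "meet F \<le> - a \<Longrightarrow> a \<in> I" if "finite F" "F \<subseteq> uminus ` I" for F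
    using that I unfolding ba_ideal_def by (metis compl_le_swap1)
  then have "fip (insert a (uminus ` I))" using a by (metis not_fip_insertE)
  then obtain U where U: "ultrafilter U" "a \<in> U" "\<And>i. i \<in> I \<Longrightarrow> - i \<in> U"
    using ultrafilter_exists by blast
  then have "U \<inter> I = {}" using ultrafilter_uminus[OF U(1)] by blast
  with U show ?thesis by blast
qed

lemma ultrafilter_ideal_equivD:
  assumes "ultrafilter U" "U \<inter> I = {}" "ba_ideal I" "a - b \<in> I" "a \<in> U"
  shows "b \<in> U"
  using assms by (metis disjoint_iff ultrafilter_diff)

section \<open>The ideal of a closed set\<close>

text \<open>Under Stone duality these are the clopen sets disjoint from \<open>Y\<close>, and the
  quotient is the clopen algebra of the closure of \<open>Y\<close>; \<open>Y\<close> itself may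
  fail to be closed.\<close>

definition null_ideal :: "'a::boolean_algebra set set \<Rightarrow> 'a set" where
  "null_ideal Y = {a. \<forall>U\<in>Y. a \<notin> U}"

lemma ba_ideal_null_ideal:
  assumes "\<forall>U\<in>Y. ultrafilter U"
  shows "ba_ideal (null_ideal Y)"
  using assms unfolding ba_ideal_def null_ideal_def by (auto dest: ultrafilter_mono)

lemma diff_in_null_ideal:
  assumes "\<forall>U\<in>Y. ultrafilter U"
  shows "a - b \<in> null_ideal Y \<longleftrightarrow> (\<forall>U\<in>Y. a \<in> U \<longrightarrow> b \<in> U)"
  using assms unfolding null_ideal_def by auto

text \<open>Modulo \<open>null_ideal Y\<close> the order is inclusion of traces on \<open>Y\<close>,
  so the classes of the \<open>d x\<close> form a chain ordered like \<open>m\<close> on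
  \<open>A\<close>. The subset \<open>A\<close> allows indices to be thinned out.\<close>

lemma chain_le_Depth:
  fixes d :: "'m \<Rightarrow> 'a::boolean_algebra"
  assumes Y: "\<forall>U\<in>Y. ultrafilter U" and W: "Well_order m" and A: "A \<subseteq> Field m"
    and le: "\<And>x y U. x \<in> A \<Longrightarrow> y \<in> A \<Longrightarrow> (x, y) \<in> m \<Longrightarrow> x \<noteq> y \<Longrightarrow> U \<in> Y \<Longrightarrow> d x \<in> U \<Longrightarrow> d y \<in> U"
    and less: "\<And>x y. x \<in> A \<Longrightarrow> y \<in> A \<Longrightarrow> (x, y) \<in> m \<Longrightarrow> x \<noteq> y \<Longrightarrow> \<exists>U\<in>Y. d y \<in> U \<and> d x \<notin> U"
  shows "|A| \<le>o Depth (quotient_order (null_ideal Y))"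
proof -
  let ?I = "null_ideal Y" and ?s = "Restr m A"
  define c where "c x = ideal_equiv ?I `` {d x}" for x
  note I = ba_ideal_null_ideal[OF Y]
  have ord: "(c x, c y) \<in> quotient_order ?I \<longleftrightarrow> (\<forall>U\<in>Y. d x \<in> U \<longrightarrow> d y \<in> U)" for x y
    unfolding c_def quotient_order_iff[OF I] diff_in_null_ideal[OF Y] ..
  have Ws: "Well_order ?s" by (rule Well_order_Restr[OF W])
  have refl: "Refl m" and total: "Total m" using W by (simp_all add: order_on_defs)
  have Fs: "Field ?s = A" using Refl_Field_Restr2[OF refl A] .
  have iff: "(c x, c y) \<in> quotient_order ?I \<longleftrightarrow> (x, y) \<in> m" if "x \<in> A" "y \<in> A" for x y
  proof (cases "x = y")
    case True
    have "(y, y) \<in> m" using refl that A by (auto simp: refl_on_def)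
    then show ?thesis using True ord by simp
  next
    case False
    then have "(x, y) \<in> m \<or> (y, x) \<in> m" using total that A unfolding total_on_def by blast
    moreover have "\<not> ((x, y) \<in> m \<and> (y, x) \<in> m)"
      using W False by (auto simp: order_on_defs antisym_def)
    ultimately show ?thesis using le[of x y] less[of y x] False that ord by blast
  qed
  have inj: "inj_on c A"
  proof (rule inj_onI)
    fix x y assume xy: "x \<in> A" "y \<in> A" "c x = c y"
    then have "(x, y) \<in> m" "(y, x) \<in> m" using iff[of x y] iff[of y x] iff[of x x] refl A
      by (auto simp: refl_on_def)
    then show "x = y" using W by (auto simp: order_on_defs antisym_def)
  qed
  have "Restr (quotient_order ?I) (c ` A) = dir_image ?s c"
    unfolding dir_image_def using iff by auto
  then have wo: "well_order_on (c ` A) (Restr (quotient_order ?I) (c ` A))"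
    using Well_order_dir_image[OF Ws, of c] inj Fs by (simp add: dir_image_Field)
  have "c ` A \<subseteq> Field (quotient_order ?I)"
    by (subst well_order_on_Field[OF wo]) (rule mono_Field, simp)
  with wo have le: "|c ` A| \<le>o Depth (quotient_order ?I)"
    unfolding Depth_def by (intro bspec[OF card_Sup(2)]) (auto intro: card_of_Card_order)
  have "|A| =o |c ` A|"
    using inj by (intro card_of_ordIsoI) (auto simp: bij_betw_def)
  from this le show ?thesis by (rule ordIso_ordLeq_trans)
qed

section \<open>Points of a free sequence\<close>

text \<open>The prescribed memberships have the finite intersection property: indices up to
  \<open>x\<close> precede all others, which is exactly the situation in the freeness
  condition.\<close>

lemma free_sequence_ultrafilter:
  assumes free: "free_sequence r b" and x: "x \<in> Field r"
  shows "\<exists>U. ultrafilter U \<and> (\<forall>y\<in>Field r. b y \<in> U \<longleftrightarrow> (y, x) \<in> r)"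
proof -
  let ?L = "{y \<in> Field r. (y, x) \<in> r}" and ?R = "{y \<in> Field r. (y, x) \<notin> r}"
  have W: "Well_order r" using free by (simp add: free_sequence_def)
  have lt: "(y, z) \<in> r \<and> y \<noteq> z" if "y \<in> ?L" "z \<in> ?R" for y z
  proof -
    have "y \<noteq> z" using that by auto
    moreover have "(z, y) \<notin> r" using that W by (auto simp: order_on_defs trans_def)
    ultimately show ?thesis using W that unfolding order_on_defs total_on_def by blast
  qed
  have "fip (b ` ?L \<union> (\<lambda>y. - b y) ` ?R)"
    unfolding fip_def
  proof (intro allI impI)
    fix H assume H: "finite H" "H \<subseteq> b ` ?L \<union> (\<lambda>y. - b y) ` ?R"
    obtain F where F: "finite F" "F \<subseteq> ?L" "H \<inter> b ` ?L = b ` F"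
      using finite_subset_image[of "H \<inter> b ` ?L" b ?L] H by auto
    obtain G where G: "finite G" "G \<subseteq> ?R" "H \<inter> (\<lambda>y. - b y) ` ?R = (\<lambda>y. - b y) ` G"
      using finite_subset_image[of "H \<inter> (\<lambda>y. - b y) ` ?R" "\<lambda>y. - b y" ?R] H by auto
    have "meet (b ` F \<union> (\<lambda>y. - b y) ` G) \<noteq> bot"
      using free[unfolded free_sequence_def, THEN conjunct2, THEN spec, THEN spec, of F G]
        F(1,2) G(1,2) lt by blast
    moreover have "H = b ` F \<union> (\<lambda>y. - b y) ` G" using H F(3) G(3) by blast
    ultimately show "meet H \<noteq> bot" by simp
  qed
  from ultrafilter_exists[OF this]
  obtain U where U: "ultrafilter U" and sub: "b ` ?L \<union> (\<lambda>y. - b y) ` ?R \<subseteq> U"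
    by (elim exE conjE)
  have "b y \<in> U \<longleftrightarrow> (y, x) \<in> r" if "y \<in> Field r" for y
  proof (cases "(y, x) \<in> r")
    case False
    then have "- b y \<in> U" using sub that by blast
    with False U show ?thesis by simp
  qed (use sub that in blast)
  with U show ?thesis by blast
qed

lemma free_sequence_comp:
  assumes free: "free_sequence r b" and W: "Well_order s"
    and f: "\<And>x. x \<in> Field s \<Longrightarrow> f x \<in> Field r"
    and mono: "\<And>x y. (x, y) \<in> s \<Longrightarrow> (f x, f y) \<in> r" and inj: "inj_on f (Field s)"
  shows "free_sequence s (b \<circ> f)"
  unfolding free_sequence_def
proof (intro conjI allI impI W)
  fix F G
  assume *: "finite F \<and> finite G \<and> F \<subseteq> Field s \<and> G \<subseteq> Field s \<and>
    (\<forall>\<alpha>\<in>F. \<forall>\<beta>\<in>G. (\<alpha>, \<beta>) \<in> s \<and> \<alpha> \<noteq> \<beta>)"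
  have "\<forall>x\<in>f ` F. \<forall>y\<in>f ` G. (x, y) \<in> r \<and> x \<noteq> y"
  proof clarify
    fix x y assume "x \<in> F" "y \<in> G"
    then show "(f x, f y) \<in> r \<and> f x \<noteq> f y"
      using * mono[of x y] inj_onD[OF inj, of x y] by auto
  qed
  moreover have "finite (f ` F)" "finite (f ` G)" "f ` F \<subseteq> Field r" "f ` G \<subseteq> Field r"
    using * f by auto
  ultimately have "meet (b ` f ` F \<union> (\<lambda>y. - b y) ` f ` G) \<noteq> bot"
    using free unfolding free_sequence_def by blast
  then show "meet ((b \<circ> f) ` F \<union> (\<lambda>\<beta>. - (b \<circ> f) \<beta>) ` G) \<noteq> bot"
    by (simp add: image_image image_comp comp_def)
qed

section \<open>Counting functions and closing off\<close>

lemma card_of_Func_mono: "|A| \<le>o |B| \<Longrightarrow> |Func K A| \<le>o |Func K B|"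
  using cexp_mono1[of "|A|" "|B|" "|K|"] by (simp add: cexp_def Field_card_of card_of_card_order_on)

lemma ordLeq_card_of_Field: "Card_order r \<Longrightarrow> r \<le>o |Field r|" "Card_order r \<Longrightarrow> |Field r| \<le>o r"
  using card_of_Field_ordIso ordIso_iff_ordLeq by blast+

lemma Well_order_underS_mono: "Well_order s \<Longrightarrow> relChain s (underS s)"
  unfolding relChain_def by (intro allI impI underS_incr) (auto simp: order_on_defs)

text \<open>As \<open>cardSuc r\<close> is regular and \<open>|K| \<le>o r\<close>, every function
  from \<open>K\<close> into it is bounded. There are \<open>cardSuc r\<close> many initial
  segments, and each, being of size at most \<open>r\<close>, admits at most \<open>r\<close>
  functions.\<close>

theorem Hausdorff_formula:
  assumes r: "Cinfinite r" and K: "|K| \<le>o r" and F: "|Func K (Field r)| \<le>o r"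
  shows "|Func K (Field (cardSuc r))| \<le>o cardSuc r"
proof -
  let ?s = "cardSuc r"
  have s: "Cinfinite ?s" using r by (rule Cinfinite_cardSuc)
  then have W: "Well_order ?s" using card_order_on_well_order_on by blast
  have "Func K (Field ?s) \<subseteq> (\<Union>i\<in>Field ?s. Func K (underS ?s i))"
  proof
    fix f assume f: "f \<in> Func K (Field ?s)"
    have "f ` K \<subseteq> (\<Union>i\<in>Field ?s. underS ?s i)"
    proof
      fix x assume "x \<in> f ` K"
      then have "x \<in> Field ?s" using f by (auto simp: Func_def)
      then obtain y where "y \<in> Field ?s" "x \<noteq> y" "(x, y) \<in> ?s"
        using infinite_Card_order_limit[of ?s x] s unfolding cinfinite_def by blast
      then show "x \<in> (\<Union>i\<in>Field ?s. underS ?s i)" by (auto simp: underS_def)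
    qed
    from cardSuc_UNION_Cinfinite[OF r Well_order_underS_mono[OF W] this
        ordLeq_transitive[OF card_of_image K]]
    obtain i where "i \<in> Field ?s" "f ` K \<subseteq> underS ?s i" by (rule bexE)
    with f show "f \<in> (\<Union>i\<in>Field ?s. Func K (underS ?s i))" by (auto simp: Func_def)
  qed
  from card_of_mono1[OF this]
  have "|Func K (Field ?s)| \<le>o |\<Union>i\<in>Field ?s. Func K (underS ?s i)|" .
  also have "|\<Union>i\<in>Field ?s. Func K (underS ?s i)| \<le>o ?s"
  proof (rule UNION_Cinfinite_bound)
    show "|Field ?s| \<le>o ?s" using s by (simp add: ordLeq_card_of_Field)
    show "\<forall>i\<in>Field ?s. |Func K (underS ?s i)| \<le>o ?s"
    proof
      fix i assume "i \<in> Field ?s"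
      then have "|underS ?s i| <o ?s" using s by (intro card_of_underS) auto
      then have "|underS ?s i| \<le>o r"
        using r by (simp add: cardSuc_ordLeq_ordLess card_of_Card_order)
      then have "|underS ?s i| \<le>o |Field r|"
        using r ordLeq_card_of_Field(1) ordLeq_transitive by blast
      then have "|Func K (underS ?s i)| \<le>o r"
        using card_of_Func_mono F ordLeq_transitive by blast
      then show "|Func K (underS ?s i)| \<le>o ?s"
        using r cardSuc_ordLeq ordLeq_transitive by blast
    qed
  qed (rule s)
  finally show ?thesis .
qed

lemma card_of_Func_Times_ordLeq:
  assumes "Cinfinite s" "|Func K (Field s)| \<le>o s" "|X| \<le>o s"
  shows "|Func K (X \<times> X)| \<le>o s"
proof -
  have X: "|X| \<le>o |Field s|"
    using assms(1,3) ordLeq_card_of_Field(1) ordLeq_transitive by blast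
  have "|X \<times> X| \<le>o |Field s \<times> Field s|"
    using card_of_Times_mono1[OF X, of X] card_of_Times_mono2[OF X, of "Field s"]
    by (rule ordLeq_transitive)
  also have "|Field s \<times> Field s| \<le>o |Field s|"
    using card_of_Times_same_infinite assms(1) unfolding cinfinite_def
    by (intro ordIso_imp_ordLeq) blast
  finally have "|Func K (X \<times> X)| \<le>o |Func K (Field s)|" by (rule card_of_Func_mono)
  then show ?thesis using assms(2) by (rule ordLeq_transitive)
qed

text \<open>Closing off in \<open>cardSuc r\<close> many stages: by regularity a
  \<open>K\<close>-indexed family of pairs from the union already lies in one stage, and any later
  stage contains \<open>G e\<close>.\<close>

lemma closed_set_exists:
  fixes G :: "('k \<Rightarrow> 'x \<times> 'x) \<Rightarrow> 'x set"
  assumes r: "Cinfinite r" and K: "|K| \<le>o r" and F: "|Func K (Field (cardSuc r))| \<le>o cardSuc r"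
    and G: "\<And>e. |G e| \<le>o cardSuc r"
  shows "\<exists>M. a \<in> M \<and> |M| \<le>o cardSuc r \<and> (\<forall>e\<in>Func K (M \<times> M). G e \<subseteq> M)"
proof -
  let ?s = "cardSuc r"
  have s: "Cinfinite ?s" using r by (rule Cinfinite_cardSuc)
  then have W: "Well_order ?s" using card_order_on_well_order_on by blast
  define H where "H X = X \<union> (\<Union>e\<in>Func K (X \<times> X). G e)" for X
  have H: "|H X| \<le>o ?s" if X: "|X| \<le>o ?s" for X
  proof -
    have "|\<Union>e\<in>Func K (X \<times> X). G e| \<le>o ?s"
      using card_of_Func_Times_ordLeq[OF s F X] G s by (intro UNION_Cinfinite_bound) auto
    then show ?thesis unfolding H_def using X s by (intro Un_Cinfinite_bound) auto
  qed
  \<comment> \<open>Stage \<open>i\<close> collects the closures \<open>H\<close> of all earlier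
    stages; \<open>insert a\<close> provides the start, as the first stage has no
    predecessor.\<close>
  have "\<exists>As. \<forall>i. As i = insert a (\<Union>j\<in>underS ?s i. H (As j))"
    by (rule dependent_wf_choice[of "?s - Id"])
      (use W in \<open>auto simp: underS_def well_order_on_def\<close>)
  then obtain As where As: "\<And>i. As i = insert a (\<Union>j\<in>underS ?s i. H (As j))" by blast
  have le_s: "|As i| \<le>o ?s" for i
  proof (induction i rule: wf_induct[of "?s - Id"])
    case 1
    show ?case using W by (simp add: well_order_on_def)
  next
    case (2 i)
    have "|underS ?s i| \<le>o ?s"
      using ordLeq_transitive[OF card_of_mono1 ordLeq_card_of_Field(2)] s
      by (metis Order_Relation.underS_Field)
    moreover have "\<forall>j\<in>underS ?s i. |H (As j)| \<le>o ?s"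
      using 2 H by (auto simp: underS_def)
    ultimately have "|\<Union>j\<in>underS ?s i. H (As j)| \<le>o ?s" using s by (rule UNION_Cinfinite_bound)
    moreover have "|{a}| \<le>o ?s"
      using s Field_cardSuc_not_empty r by (intro Card_order_singl_ordLeq) auto
    ultimately have "|{a} \<union> (\<Union>j\<in>underS ?s i. H (As j))| \<le>o ?s"
      using s by (intro Un_Cinfinite_bound) auto
    then show ?case by (subst As) simp
  qed
  have mono: "As i \<subseteq> As j" if "(i, j) \<in> ?s" for i j
  proof -
    have "underS ?s i \<subseteq> underS ?s j" using Well_order_underS_mono[OF W] that by (simp add: relChain_def)
    then show ?thesis by (subst (1 2) As) blast
  qed
  \<comment> \<open>Squares are used so that both coordinates of a pair are found in the same
    stage.\<close>
  have chain: "relChain ?s (\<lambda>i. As i \<times> As i)"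
    unfolding relChain_def using mono by blast
  define M where "M = (\<Union>i\<in>Field ?s. As i)"
  have "|M| \<le>o ?s"
    unfolding M_def using ordLeq_card_of_Field(2) s le_s by (intro UNION_Cinfinite_bound) auto
  moreover have "a \<in> M"
    unfolding M_def using Field_cardSuc_not_empty r As by blast
  moreover have "G e \<subseteq> M" if e: "e \<in> Func K (M \<times> M)" for e
  proof -
    have "e ` K \<subseteq> (\<Union>i\<in>Field ?s. As i \<times> As i)"
    proof
      fix p assume "p \<in> e ` K"
      then obtain x y i j where p: "p = (x, y)" "i \<in> Field ?s" "x \<in> As i" "j \<in> Field ?s" "y \<in> As j"
        using e unfolding Func_def M_def by fastforce
      have "(i, j) \<in> ?s \<or> (j, i) \<in> ?s"
        using p W by (cases "i = j") (auto simp: order_on_defs total_on_def refl_on_def)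
      then show "p \<in> (\<Union>i\<in>Field ?s. As i \<times> As i)" using p mono by blast
    qed
    from cardSuc_UNION_Cinfinite[OF r chain this ordLeq_transitive[OF card_of_image K]]
    obtain i where i: "i \<in> Field ?s" "e ` K \<subseteq> As i \<times> As i" by (rule bexE)
    obtain j where j: "j \<in> Field ?s" "i \<noteq> j" "(i, j) \<in> ?s"
      using infinite_Card_order_limit[of ?s i] s i unfolding cinfinite_def by blast
    have "e \<in> Func K (As i \<times> As i)" using e i(2) by (auto simp: Func_def)
    then have "G e \<subseteq> H (As i)" unfolding H_def by blast
    also have "\<dots> \<subseteq> As j" using j by (subst As[of j]) (auto simp: underS_def)
    also have "\<dots> \<subseteq> M" unfolding M_def using j by blast
    finally show ?thesis .
  qed
  ultimately show ?thesis by blast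
qed

section \<open>Intervals that are not split\<close>

text \<open>\<open>R j x i y\<close> is to be read as: the chosen point of block \<open>x\<close> in
  family \<open>j\<close> lies in the generator at \<open>y\<close> of family \<open>i\<close>. The
  intervals are built by recursion along a well-order of \<open>K\<close>; what makes each step
  possible is that \<open>d\<close> stays an admissible left end while lying outside
  \<open>M\<close>.\<close>

lemma unsplit_intervals:
  fixes R :: "'k \<Rightarrow> 'x \<Rightarrow> 'k \<Rightarrow> 'x \<Rightarrow> bool"
  assumes r: "Cinfinite r" and K: "|Pow K| \<le>o r"
    and F: "|Func K (Field (cardSuc r))| \<le>o cardSuc r"
    and W: "Well_order c" and c: "cardSuc r <o |Field c|"
  shows "\<exists>l u. \<forall>j\<in>K. (l j, u j) \<in> c \<and> l j \<noteq> u j \<and>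
    (\<forall>i\<in>K. i \<noteq> j \<longrightarrow> (R j (l j) i (l i) \<longleftrightarrow> R j (l j) i (u i)))"
proof -
  let ?s = "cardSuc r"
  have s: "Cinfinite ?s" using r by (rule Cinfinite_cardSuc)
  have Kr: "|K| \<le>o r" using card_of_Pow K ordLeq_transitive ordLess_imp_ordLeq by blast
  \<comment> \<open>The candidates for the left end of interval \<open>j\<close>: their points split
    none of the intervals \<open>e i\<close>.\<close>
  define S where "S e j = {x \<in> Field c. \<forall>i\<in>K. R j x i (fst (e i)) \<longleftrightarrow> R j x i (snd (e i))}" for e j
  \<comment> \<open>\<open>B e j\<close> has to be small enough to fit into \<open>M\<close>, and
    yet either exhaust \<open>S e j\<close> or be large enough for a pigeonhole argument with
    \<open>r\<close> holes.\<close>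
  have "\<exists>B. B \<subseteq> S e j \<and> |B| \<le>o ?s \<and> (B = S e j \<or> r <o |B| )" for e j
  proof (cases "|S e j| \<le>o ?s")
    case False
    then have "?s \<le>o |S e j|"
      using ordLess_or_ordLeq[OF card_order_on_well_order_on card_of_Well_order] s ordLess_imp_ordLeq
        ordLeq_total[OF card_order_on_well_order_on card_of_Well_order] by blast
    then have "|Field ?s| \<le>o |S e j|" using ordLeq_card_of_Field(2) s ordLeq_transitive by blast
    then obtain B where B: "B \<subseteq> S e j" "|Field ?s| =o |B|"
      using internalize_card_of_ordLeq2[of "Field ?s" "S e j"] by blast
    then have sB: "?s =o |B|" using card_of_Field_ordIso s ordIso_symmetric ordIso_transitive by blast
    moreover have "r <o |B|" using cardSuc_greater r sB ordLess_ordIso_trans by blast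
    ultimately show ?thesis using B ordIso_iff_ordLeq by blast
  qed blast
  then obtain B where B: "\<And>e j. B e j \<subseteq> S e j" "\<And>e j. |B e j| \<le>o ?s"
      "\<And>e j. B e j = S e j \<or> r <o |B e j|"
    by metis
  have "|\<Union>j\<in>K. B e j| \<le>o ?s" for e
    using B(2) s ordLeq_transitive[OF Kr cardSuc_ordLeq] r by (intro UNION_Cinfinite_bound) auto
  then obtain a M where M: "a \<in> M" "|M| \<le>o ?s" "\<And>e. e \<in> Func K (M \<times> M) \<Longrightarrow> (\<Union>j\<in>K. B e j) \<subseteq> M"
    using closed_set_exists[OF r Kr F, of "\<lambda>e. \<Union>j\<in>K. B e j"] by metis
  have "|M| <o |Field c|" using M(2) c by (rule ordLeq_ordLess_trans)
  then have "\<not> Field c \<subseteq> M" using card_of_mono1 not_ordLess_ordLeq by blast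
  then obtain d where d: "d \<in> Field c" "d \<notin> M" by blast
  let ?K = "|K| - Id"
  have WK: "Well_order |K|" by (rule card_of_Well_order)
  have KK: "i \<in> K" "j \<in> K" if "(i, j) \<in> ?K" for i j
    using that FieldI1[of i j "|K|"] FieldI2[of i j "|K|"] by (simp_all add: Field_card_of)
  \<comment> \<open>The clause on \<open>d\<close> says that the points of block \<open>d\<close> do
    not split the new interval, which keeps \<open>d\<close> a candidate at all later steps. The
    last two clauses compare the new point with earlier intervals and the earlier points with the
    new interval.\<close>
  define P where "P f j p \<longleftrightarrow> (j \<in> K \<longrightarrow> (case p of (x, y) \<Rightarrow>
      x \<in> M \<and> y \<in> M \<and> (x, y) \<in> c \<and> x \<noteq> y \<and> (\<forall>k\<in>K. R k d j x \<longleftrightarrow> R k d j y) \<and>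
      (\<forall>i. (i, j) \<in> ?K \<longrightarrow> (R j x i (fst (f i)) \<longleftrightarrow> R j x i (snd (f i))) \<and>
        (R i (fst (f i)) j x \<longleftrightarrow> R i (fst (f i)) j y))))" for f j p
  have "\<exists>f. \<forall>j. P f j (f j)"
  proof (rule dependent_wf_choice[of ?K])
    show "wf ?K" using WK by (simp add: well_order_on_def)
    show "P f x p = P g x p" if "\<And>z. (z, x) \<in> ?K \<Longrightarrow> f z = g z" for f g x p
      using that unfolding P_def by (auto split: prod.splits)
    fix j f assume IH: "\<And>i. (i, j) \<in> ?K \<Longrightarrow> P f i (f i)"
    show "\<exists>p. P f j p"
    proof (cases "j \<in> K")
      case j: True
      \<comment> \<open>Indices not yet treated get the degenerate interval \<open>(a, a)\<close>,
        which no point splits; so \<open>e\<close> is a function on all of \<open>K\<close> to which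
        the closure of \<open>M\<close> applies.\<close>
      define e where "e i = (if i \<in> K then if (i, j) \<in> ?K then f i else (a, a) else undefined)" for i
      have IH': "f i \<in> M \<times> M" "R j d i (fst (f i)) \<longleftrightarrow> R j d i (snd (f i))" if "(i, j) \<in> ?K" for i
        using IH[OF that] KK(1)[OF that] j unfolding P_def by (auto split: prod.splits)
      have e: "e \<in> Func K (M \<times> M)"
        unfolding Func_def e_def using IH'(1) M(1) by auto
      have "d \<in> S e j" unfolding S_def e_def using d(1) IH'(2) by auto
      \<comment> \<open>Since \<open>d\<close> lies outside \<open>M\<close>, the part of \<open>S e j\<close> in \<open>M\<close> is larger than the number of
        traces \<open>q x\<close>.\<close>
      then have "B e j \<noteq> S e j" using M(3)[OF e] j d(2) by blast
      then have less: "r <o |B e j|" using B(3) by blast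
      \<comment> \<open>\<open>q x\<close> records which earlier left-end points and which points of
        block \<open>d\<close> lie in the generator at \<open>x\<close>. Two elements of
        \<open>B e j\<close> with the same record bound an interval that none of these points
        splits.\<close>
      define q where "q x = ({i \<in> K. R i (fst (f i)) j x}, {k \<in> K. R k d j x})" for x
      have "|Pow K \<times> Pow K| \<le>o r"
        using cprod_cinfinite_bound[OF K K card_of_Card_order card_of_Card_order r]
        by (simp add: cprod_def Field_card_of)
      then have "|Pow K \<times> Pow K| <o |B e j|" using less by (rule ordLeq_ordLess_trans)
      then have "\<not> |B e j| \<le>o |Pow K \<times> Pow K|" using not_ordLess_ordLeq by blast
      then have "\<not> inj_on q (B e j)"
        using card_of_ordLeqI[of q "B e j" "Pow K \<times> Pow K"] unfolding q_def by auto
      then obtain x y where xy: "x \<in> B e j" "y \<in> B e j" "q x = q y" "x \<noteq> y"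
        unfolding inj_on_def by blast
      \<comment> \<open>Both elements lie in \<open>S e j\<close>, so whichever is smaller can serve
        as the left end.\<close>
      have *: "P f j (x, y)" if xy: "x \<in> B e j" "y \<in> B e j" "q x = q y" "x \<noteq> y" "(x, y) \<in> c" for x y
      proof -
        have "x \<in> M" "y \<in> M" using xy M(3)[OF e] j by blast+
        moreover have "R k d j x \<longleftrightarrow> R k d j y" if "k \<in> K" for k
          using xy(3) that unfolding q_def by blast
        moreover have "R j x i (fst (f i)) \<longleftrightarrow> R j x i (snd (f i))" if "(i, j) \<in> ?K" for i
        proof -
          have "x \<in> S e j" using xy B(1) by blast
          then have "R j x i (fst (e i)) \<longleftrightarrow> R j x i (snd (e i))"
            unfolding S_def using KK(1)[OF that] by blast
          then show ?thesis unfolding e_def using KK(1)[OF that] that by simp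
        qed
        moreover have "R i (fst (f i)) j x \<longleftrightarrow> R i (fst (f i)) j y" if "(i, j) \<in> ?K" for i
          using xy(3) KK(1)[OF that] unfolding q_def by blast
        ultimately show ?thesis using xy(4,5) unfolding P_def by simp
      qed
      have "x \<in> Field c" "y \<in> Field c" using xy B(1) unfolding S_def by blast+
      then have "(x, y) \<in> c \<or> (y, x) \<in> c"
        using W xy(4) unfolding order_on_defs total_on_def by blast
      then show ?thesis using *[of x y] *[of y x] xy by metis
    qed (simp add: P_def)
  qed
  then obtain f where f: "\<And>j. P f j (f j)" by blast
  have fj: "(fst (f j), snd (f j)) \<in> c" "fst (f j) \<noteq> snd (f j)" if "j \<in> K" for j
    using f[of j] that unfolding P_def by (auto split: prod.splits)
  have fij: "R j (fst (f j)) i (fst (f i)) \<longleftrightarrow> R j (fst (f j)) i (snd (f i))"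
      "R i (fst (f i)) j (fst (f j)) \<longleftrightarrow> R i (fst (f i)) j (snd (f j))" if "(i, j) \<in> ?K" for i j
    using f[of j] that KK(2)[OF that] unfolding P_def by (auto split: prod.splits)
  have "(i, j) \<in> ?K \<or> (j, i) \<in> ?K" if "i \<in> K" "j \<in> K" "i \<noteq> j" for i j
    using WK that unfolding order_on_defs total_on_def Field_card_of by blast
  \<comment> \<open>Of two distinct indices, the later one carries the conditions in both
    directions.\<close>
  then have "R j (fst (f j)) i (fst (f i)) \<longleftrightarrow> R j (fst (f j)) i (snd (f i))"
    if "i \<in> K" "j \<in> K" "i \<noteq> j" for i j
    using that fij by metis
  then show ?thesis
    by (intro exI[of _ "\<lambda>j. fst (f j)"] exI[of _ "\<lambda>j. snd (f j)"]) (use fj in simp)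
qed

text \<open>Diagonal argument: \<open>E j\<close> contains the choices \<open>e\<close> for which at
  most \<open>|V j|\<close> many \<open>\<alpha>\<close> work. There are at most
  \<open>|V j|\<close> choices, so some \<open>\<alpha> j\<close> in \<open>A j\<close> avoids all
  these small sets \<open>T e j\<close>. Intervals that are good for the single points
  \<open>\<alpha> j\<close> put \<open>\<alpha> j\<close> into \<open>T e j\<close>, which is
  therefore large.\<close>

lemma unsplit_intervals_large:
  fixes Q :: "'k \<Rightarrow> 'x \<Rightarrow> 'm \<Rightarrow> 'k \<Rightarrow> 'x \<Rightarrow> bool" and V :: "'k \<Rightarrow> 'v set"
  assumes r: "Cinfinite r" and K: "|Pow K| \<le>o r"
    and F: "|Func K (Field (cardSuc r))| \<le>o cardSuc r"
    and W: "Well_order c" and c: "cardSuc r <o |Field c|"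
    and Fc: "|Func K (Field c \<times> Field c)| \<le>o |Field c|"
    and V: "\<And>j. j \<in> K \<Longrightarrow> infinite (V j)" "\<And>j. j \<in> K \<Longrightarrow> |Field c| \<le>o |V j|"
    and VA: "\<And>j. j \<in> K \<Longrightarrow> |V j| <o |A j|"
  shows "\<exists>l u. \<forall>j\<in>K. (l j, u j) \<in> c \<and> l j \<noteq> u j \<and>
    |V j| <o |{\<alpha> \<in> A j. \<forall>i\<in>K. i \<noteq> j \<longrightarrow> (Q j (l j) \<alpha> i (l i) \<longleftrightarrow> Q j (l j) \<alpha> i (u i))}|"
proof -
  define T where "T e j = {\<alpha> \<in> A j. \<forall>i\<in>K. i \<noteq> j \<longrightarrow>
    (Q j (fst (e j)) \<alpha> i (fst (e i)) \<longleftrightarrow> Q j (fst (e j)) \<alpha> i (snd (e i)))}" for e j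
  define E where "E j = {e \<in> Func K (Field c \<times> Field c). |T e j| \<le>o |V j|}" for j
  have "\<exists>\<alpha>. \<alpha> \<in> A j \<and> (\<forall>e\<in>E j. \<alpha> \<notin> T e j)" if j: "j \<in> K" for j
  proof -
    have "|E j| \<le>o |Func K (Field c \<times> Field c)|" unfolding E_def by (rule card_of_mono1) blast
    from ordLeq_transitive[OF ordLeq_transitive[OF this Fc] V(2)[OF j]] have "|E j| \<le>o |V j|" .
    then have "|\<Union>e\<in>E j. T e j| \<le>o |V j|"
      using V(1)[OF j] by (intro card_of_UNION_ordLeq_infinite) (auto simp: E_def)
    then have "|\<Union>e\<in>E j. T e j| <o |A j|" using VA[OF j] by (rule ordLeq_ordLess_trans)
    then have "\<not> A j \<subseteq> (\<Union>e\<in>E j. T e j)" using card_of_mono1 not_ordLess_ordLeq by blast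
    then show ?thesis by blast
  qed
  then obtain \<alpha> where \<alpha>: "\<And>j. j \<in> K \<Longrightarrow> \<alpha> j \<in> A j" "\<And>j e. j \<in> K \<Longrightarrow> e \<in> E j \<Longrightarrow> \<alpha> j \<notin> T e j"
    by metis
  obtain l u where lu: "\<And>j. j \<in> K \<Longrightarrow> (l j, u j) \<in> c" "\<And>j. j \<in> K \<Longrightarrow> l j \<noteq> u j"
      "\<And>i j. j \<in> K \<Longrightarrow> i \<in> K \<Longrightarrow> i \<noteq> j \<Longrightarrow> Q j (l j) (\<alpha> j) i (l i) \<longleftrightarrow> Q j (l j) (\<alpha> j) i (u i)"
    using unsplit_intervals[OF r K F W c, of "\<lambda>j x. Q j x (\<alpha> j)"] by blast
  define e where "e j = (if j \<in> K then (l j, u j) else undefined)" for j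
  have e: "e \<in> Func K (Field c \<times> Field c)"
    unfolding Func_def e_def using lu(1) by (auto intro: FieldI1 FieldI2)
  have "|V j| <o |T e j|" if j: "j \<in> K" for j
  proof -
    have "\<alpha> j \<in> T e j" unfolding T_def e_def using \<alpha>(1) lu(3) j by auto
    then have "e \<notin> E j" using \<alpha>(2) j by blast
    then have "\<not> |T e j| \<le>o |V j|" unfolding E_def using e by blast
    then show ?thesis
      by (simp only: not_ordLeq_iff_ordLess[OF card_of_Well_order card_of_Well_order])
  qed
  moreover have "T e j = {\<alpha> \<in> A j. \<forall>i\<in>K. i \<noteq> j \<longrightarrow>
      (Q j (l j) \<alpha> i (l i) \<longleftrightarrow> Q j (l j) \<alpha> i (u i))}" if "j \<in> K" for j
    unfolding T_def e_def using that by simp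
  ultimately show ?thesis using lu(1,2)
    by (intro exI[of _ l] exI[of _ u]) simp
qed

section \<open>An ideal from sufficiently many free sequences\<close>

definition lex_order :: "'x rel \<Rightarrow> 'm rel \<Rightarrow> ('x \<times> 'm) rel" where
  "lex_order c w = {((x, a), (y, b)). x \<in> Field c \<and> y \<in> Field c \<and> a \<in> Field w \<and> b \<in> Field w \<and>
     ((x, y) \<in> c \<and> x \<noteq> y \<or> x = y \<and> (a, b) \<in> w)}"

lemma lex_order_iff:
  "((x, a), (y, b)) \<in> lex_order c w \<longleftrightarrow> x \<in> Field c \<and> y \<in> Field c \<and> a \<in> Field w \<and> b \<in> Field w \<and>
     ((x, y) \<in> c \<and> x \<noteq> y \<or> x = y \<and> (a, b) \<in> w)"
  by (simp add: lex_order_def)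

lemma
  assumes c: "Well_order c" and w: "Well_order w"
  shows Field_lex_order: "Field (lex_order c w) = Field c \<times> Field w"
    and Well_order_lex_order: "Well_order (lex_order c w)"
proof -
  let ?p = "lex_order c w"
  have refl_w: "(a, a) \<in> w" if "a \<in> Field w" for a
    using w that by (simp add: order_on_defs refl_on_def)
  show F: "Field ?p = Field c \<times> Field w"
  proof
    have "?p \<subseteq> (Field c \<times> Field w) \<times> (Field c \<times> Field w)"
      by (auto simp: lex_order_def)
    then show "Field ?p \<subseteq> Field c \<times> Field w" unfolding Field_def by blast
    show "Field c \<times> Field w \<subseteq> Field ?p"
    proof clarify
      fix x a assume "x \<in> Field c" "a \<in> Field w"
      then have "((x, a), (x, a)) \<in> ?p" using refl_w by (simp add: lex_order_iff)
      then show "(x, a) \<in> Field ?p" by (rule FieldI1)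
    qed
  qed
  have "?p - Id \<subseteq> (c - Id) <*lex*> (w - Id)"
    by (auto simp: lex_order_def)
  then have "wf (?p - Id)"
    using c w by (auto simp: well_order_on_def intro: wf_subset)
  moreover have "?p \<subseteq> Field ?p \<times> Field ?p" by (auto intro: FieldI1 FieldI2)
  moreover have "Refl ?p"
    unfolding F using refl_w by (auto simp: refl_on_def lex_order_iff)
  moreover have "trans ?p"
  proof (rule transI)
    fix p q s assume "(p, q) \<in> ?p" "(q, s) \<in> ?p"
    moreover have "trans c" "trans w" "antisym c" using c w by (simp_all add: order_on_defs)
    ultimately show "(p, s) \<in> ?p"
      unfolding trans_def antisym_def by (cases p; cases q; cases s; simp add: lex_order_iff) blast
  qed
  moreover have "antisym ?p"
  proof (rule antisymI)
    fix p q assume "(p, q) \<in> ?p" "(q, p) \<in> ?p"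
    moreover have "antisym c" "antisym w" using c w by (simp_all add: order_on_defs)
    ultimately show "p = q"
      unfolding antisym_def by (cases p; cases q; simp add: lex_order_iff) blast
  qed
  moreover have "Total ?p"
  proof -
    have "Total c" "Total w" using c w by (simp_all add: order_on_defs)
    then show ?thesis unfolding F unfolding total_on_def by (auto simp: lex_order_iff)
  qed
  ultimately show "Well_order ?p" by (simp add: order_on_defs)
qed

text \<open>Well-orders are comparable, so the one with the smaller field embeds into
  \<open>r\<close>, and a free sequence can be pulled back along the embedding.\<close>

lemma free_sequence_of_order:
  fixes r :: "'i rel" and b :: "'i \<Rightarrow> 'a::boolean_algebra" and P :: "'p rel"
  assumes free: "free_sequence r b" and P: "Well_order P" and less: "|Field P| <o |Field r|"
  shows "\<exists>b' :: 'p \<Rightarrow> 'a. free_sequence P b'"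
proof -
  have W: "Well_order r" using free by (simp add: free_sequence_def)
  have "\<not> r \<le>o P" using card_of_mono2 less not_ordLess_ordLeq by blast
  then have "P \<le>o r" using not_ordLeq_iff_ordLess[OF P W] ordLess_imp_ordLeq by blast
  then obtain f where f: "embed P r f" unfolding ordLeq_def by blast
  have "free_sequence P (b \<circ> f)"
  proof (rule free_sequence_comp[OF free P])
    show "f x \<in> Field r" if "x \<in> Field P" for x by (rule embed_in_Field[OF f that])
    show "(f x, f y) \<in> r" if "(x, y) \<in> P" for x y
      using embed_compat[OF f] that unfolding compat_def by blast
    show "inj_on f (Field P)" by (rule embed_inj_on[OF P f])
  qed
  then show ?thesis by blast
qed

lemma Well_order_least:
  assumes "Well_order w" "Field w \<noteq> {}"
  shows "\<exists>z\<in>Field w. \<forall>a\<in>Field w. (z, a) \<in> w"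
proof -
  have "wf (w - Id)" and tot: "Total w" and refl: "Refl w" using assms(1) by (simp_all add: order_on_defs)
  then obtain z where z: "z \<in> Field w" "\<And>y. (y, z) \<in> w - Id \<Longrightarrow> y \<notin> Field w"
    using assms(2) wfE_min'[of "w - Id" "Field w"] by metis
  have "(z, a) \<in> w" if "a \<in> Field w" for a
  proof (cases "a = z")
    case True
    then show ?thesis using refl z(1) by (simp add: refl_on_def)
  next
    case False
    then show ?thesis using tot z(1) z(2)[of a] that unfolding total_on_def by blast
  qed
  with z(1) show ?thesis by blast
qed

text \<open>Each family contributes to \<open>Y\<close> those points of its block \<open>l j\<close>
  that split no other interval. One set \<open>Y\<close> thus carries, for every \<open>j\<close>, a
  chain longer than \<open>|V j|\<close>.\<close>

lemma ideal_of_free_sequences: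
  fixes b :: "'k \<Rightarrow> 'x \<times> 'm \<Rightarrow> 'a::boolean_algebra" and V :: "'k \<Rightarrow> 'v set"
  assumes r: "Cinfinite r" and K: "|Pow K| \<le>o r"
    and F: "|Func K (Field (cardSuc r))| \<le>o cardSuc r"
    and c: "Well_order c" "cardSuc r <o |Field c|" "|Func K (Field c \<times> Field c)| \<le>o |Field c|"
    and V: "\<And>j. j \<in> K \<Longrightarrow> infinite (V j)" "\<And>j. j \<in> K \<Longrightarrow> |Field c| \<le>o |V j|"
    and w: "\<And>j. j \<in> K \<Longrightarrow> Well_order (w j)" "\<And>j. j \<in> K \<Longrightarrow> |V j| <o |Field (w j)|"
    and b: "\<And>j. j \<in> K \<Longrightarrow> free_sequence (lex_order c (w j)) (b j)"
  shows "\<exists>I :: 'a set. ba_ideal I \<and> (\<forall>j\<in>K. |V j| <o Depth (quotient_order I))"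
proof -
  \<comment> \<open>\<open>(x, z j)\<close> is the first index of block \<open>x\<close>, so
    \<open>b j (x, z j)\<close> belongs to the point at \<open>(y, \<alpha>)\<close> iff
    \<open>x\<close> is at most \<open>y\<close>: it compares blocks only.\<close>
  have "\<exists>z\<in>Field (w j). \<forall>a\<in>Field (w j). (z, a) \<in> w j" if j: "j \<in> K" for j
  proof (rule Well_order_least[OF w(1)[OF j]])
    show "Field (w j) \<noteq> {}"
      using w(2)[OF j] card_of_empty[of "V j"] not_ordLess_ordLeq by metis
  qed
  then obtain z where z: "\<And>j. j \<in> K \<Longrightarrow> z j \<in> Field (w j)"
      "\<And>j a. j \<in> K \<Longrightarrow> a \<in> Field (w j) \<Longrightarrow> (z j, a) \<in> w j"
    by metis
  have "\<exists>U. ultrafilter U \<and> (\<forall>q\<in>Field c \<times> Field (w j). b j q \<in> U \<longleftrightarrow> (q, p) \<in> lex_order c (w j))"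
    if "j \<in> K" "p \<in> Field c \<times> Field (w j)" for j p
    using free_sequence_ultrafilter[OF b[OF that(1)], of p] that
    by (simp add: Field_lex_order[OF c(1) w(1)])
  then obtain X where X: "\<And>j p. j \<in> K \<Longrightarrow> p \<in> Field c \<times> Field (w j) \<Longrightarrow> ultrafilter (X j p)"
    and bX: "\<And>j p q. j \<in> K \<Longrightarrow> p \<in> Field c \<times> Field (w j) \<Longrightarrow> q \<in> Field c \<times> Field (w j) \<Longrightarrow>
      b j q \<in> X j p \<longleftrightarrow> (q, p) \<in> lex_order c (w j)"
    by metis
  define T where "T l u j = {\<alpha> \<in> Field (w j). \<forall>i\<in>K. i \<noteq> j \<longrightarrow>
    (b i (l i, z i) \<in> X j (l j, \<alpha>) \<longleftrightarrow> b i (u i, z i) \<in> X j (l j, \<alpha>))}" for l u j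
  have "\<exists>l u. \<forall>j\<in>K. (l j, u j) \<in> c \<and> l j \<noteq> u j \<and> |V j| <o |T l u j|"
    unfolding T_def by (rule unsplit_intervals_large[OF r K F c]) (use V w in auto)
  then obtain l u where lu: "\<And>j. j \<in> K \<Longrightarrow> (l j, u j) \<in> c" "\<And>j. j \<in> K \<Longrightarrow> l j \<noteq> u j"
      "\<And>j. j \<in> K \<Longrightarrow> |V j| <o |T l u j|"
    by blast
  have luF: "l j \<in> Field c" "u j \<in> Field c" if "j \<in> K" for j
    using lu(1)[OF that] by (auto intro: FieldI1 FieldI2)
  have lu': "(u j, l j) \<notin> c" if "j \<in> K" for j
    using lu(1,2)[OF that] c(1) by (auto simp: order_on_defs antisym_def)
  define Y where "Y = {X j (l j, \<alpha>) | j \<alpha>. j \<in> K \<and> \<alpha> \<in> T l u j}"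
  have T: "T l u j \<subseteq> Field (w j)" for j by (auto simp: T_def)
  have Y: "\<forall>U\<in>Y. ultrafilter U"
    unfolding Y_def using X luF T by blast
  have "|V j| <o Depth (quotient_order (null_ideal Y))" if j: "j \<in> K" for j
  proof -
    \<comment> \<open>On \<open>Y\<close> the first difference selects the points of family
      \<open>j\<close>; removing \<open>b j (l j, \<alpha>)\<close> leaves those at positions
      strictly below \<open>\<alpha>\<close>, so \<open>d\<close> increases with
      \<open>\<alpha>\<close>.\<close>
    define d where "d \<alpha> = b j (l j, z j) - b j (u j, z j) - b j (l j, \<alpha>)" for \<alpha>
    have refl: "(\<alpha>, \<alpha>) \<in> w j" if "\<alpha> \<in> Field (w j)" for \<alpha>
      using w(1)[OF j] that by (simp add: order_on_defs refl_on_def)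
    have other: "d \<alpha> \<notin> X i (l i, \<beta>)" if "i \<in> K" "i \<noteq> j" "\<beta> \<in> T l u i" for i \<alpha> \<beta>
    proof -
      have U: "ultrafilter (X i (l i, \<beta>))" using X luF T that by blast
      have "b j (l j, z j) \<in> X i (l i, \<beta>) \<longleftrightarrow> b j (u j, z j) \<in> X i (l i, \<beta>)"
        using that(2) j \<open>\<beta> \<in> T l u i\<close>[unfolded T_def] by simp
      then show ?thesis using U unfolding d_def by simp
    qed
    have same: "d \<alpha> \<in> X j (l j, \<beta>) \<longleftrightarrow> (\<alpha>, \<beta>) \<notin> w j"
      if "\<alpha> \<in> Field (w j)" "\<beta> \<in> Field (w j)" for \<alpha> \<beta>
    proof -
      have U: "ultrafilter (X j (l j, \<beta>))" using X luF j that by blast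
      have *: "b j (x, \<gamma>) \<in> X j (l j, \<beta>) \<longleftrightarrow> ((x, \<gamma>), (l j, \<beta>)) \<in> lex_order c (w j)"
        if "x \<in> Field c" "\<gamma> \<in> Field (w j)" for x \<gamma>
        using bX j that luF \<open>\<beta> \<in> Field (w j)\<close> by blast
      show ?thesis
        unfolding d_def using U j that luF[OF j] lu'[OF j] lu(2)[OF j] z[OF j]
        by (auto simp: * lex_order_iff)
    qed
    have "|T l u j| \<le>o Depth (quotient_order (null_ideal Y))"
    proof (rule chain_le_Depth[OF Y w(1)[OF j] T, of d])
      fix \<alpha> \<alpha>' assume \<alpha>: "\<alpha> \<in> T l u j" "\<alpha>' \<in> T l u j" "(\<alpha>, \<alpha>') \<in> w j" "\<alpha> \<noteq> \<alpha>'"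
      then have \<alpha>F: "\<alpha> \<in> Field (w j)" "\<alpha>' \<in> Field (w j)" using T by blast+
      show "d \<alpha>' \<in> U" if U: "U \<in> Y" "d \<alpha> \<in> U" for U
      proof -
        obtain \<beta> where \<beta>: "U = X j (l j, \<beta>)" "\<beta> \<in> Field (w j)"
          using U other T unfolding Y_def by blast
        moreover have "(\<alpha>, \<beta>) \<in> w j" if "(\<alpha>', \<beta>) \<in> w j"
          using \<alpha>(3) that w(1)[OF j] unfolding order_on_defs trans_def by blast
        ultimately show ?thesis using U(2) same \<alpha>F by blast
      qed
      have "(\<alpha>', \<alpha>) \<notin> w j"
        using \<alpha>(3,4) w(1)[OF j] unfolding order_on_defs antisym_def by blast
      then have "d \<alpha>' \<in> X j (l j, \<alpha>)" "d \<alpha> \<notin> X j (l j, \<alpha>)" using same \<alpha>F refl by blast+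
      moreover have "X j (l j, \<alpha>) \<in> Y" unfolding Y_def using j \<alpha>(1) by blast
      ultimately show "\<exists>U\<in>Y. d \<alpha>' \<in> U \<and> d \<alpha> \<notin> U" by blast
    qed
    with lu(3)[OF j] show ?thesis by (rule ordLess_ordLeq_trans)
  qed
  then show ?thesis using ba_ideal_null_ideal[OF Y] by blast
qed

section \<open>Upper bounds for the depth of quotients\<close>

text \<open>Minimality in \<open>card_Sup\<close> only concerns bounds on the type
  \<open>'a set\<close>, whereas \<open>t\<close> lives on \<open>'a\<close>; singletons carry it
  over.\<close>

lemma Depth_leI:
  fixes t :: "'a rel"
  assumes t: "Card_order t"
    and le: "\<And>C. C \<subseteq> Field Q \<Longrightarrow> well_order_on C (Restr Q C) \<Longrightarrow> |C :: 'a set set| \<le>o t"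
  shows "Depth Q \<le>o t"
proof -
  let ?k = "|(\<lambda>x. {x}) ` Field t|"
  have "|Field t| =o ?k" 
    by (rule card_of_ordIsoI[of "\<lambda>x. {x}"]) (simp add: bij_betw_def inj_on_def)
  then have k: "t =o ?k"
    using card_of_Field_ordIso[OF t] ordIso_symmetric ordIso_transitive by blast
  have "Depth Q \<le>o ?k"
    unfolding Depth_def
  proof (rule card_Sup(3))
    show "\<forall>s\<in>{|C| |C. C \<subseteq> Field Q \<and> well_order_on C (Restr Q C)}. s \<le>o ?k"
      using ordLeq_ordIso_trans[OF le k] by blast
  qed (auto intro: card_of_Card_order)
  then show ?thesis using k ordIso_symmetric ordLeq_ordIso_trans by blast
qed

lemma Linear_order_finite_max:
  assumes s: "Linear_order s" and "finite F" "F \<noteq> {}" "F \<subseteq> Field s"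
  shows "\<exists>m\<in>F. \<forall>x\<in>F. (x, m) \<in> s"
  using assms(2-4)
proof (induction rule: finite_ne_induct)
  case (singleton x)
  then show ?case using s by (simp add: order_on_defs refl_on_def)
next
  case (insert x F)
  then obtain m where m: "m \<in> F" "\<forall>y\<in>F. (y, m) \<in> s" by blast
  have refl: "(x, x) \<in> s" using s insert.prems by (simp add: order_on_defs refl_on_def)
  have "x \<noteq> m" using insert.hyps m by blast
  then consider "(x, m) \<in> s" | "(m, x) \<in> s"
    using s m(1) insert.prems unfolding order_on_defs total_on_def by blast
  then show ?case
  proof cases
    case 1
    then show ?thesis using m by blast
  next
    case 2
    then have "(y, x) \<in> s" if "y \<in> F" for y
      using m(2) that s unfolding order_on_defs trans_def by blast
    then show ?thesis using refl by blast
  qed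
qed

text \<open>With complements of representatives as the sequence, the meet to be shown nonzero is,
  modulo \<open>I\<close>, the least member of \<open>G\<close> minus the greatest member of
  \<open>F\<close>, and a strictly increasing chain keeps this out of \<open>I\<close>.\<close>

lemma quotient_chain_free_sequence:
  fixes I :: "'a::boolean_algebra set"
  assumes I: "ba_ideal I" and nontriv: "(bot :: 'a) \<noteq> top"
    and C: "C \<subseteq> Field (quotient_order I)" "well_order_on C (Restr (quotient_order I) C)"
    and C': "C' = C - {ideal_equiv I `` {bot}, ideal_equiv I `` {top}}"
  shows "\<exists>(s :: 'a set rel) (b :: 'a set \<Rightarrow> 'a). free_sequence s b \<and> Field s = C'"
proof -
  let ?Q = "quotient_order I"
  note E = equiv_ideal_equiv[OF I]
  note eq = eq_equiv_class_iff[OF E UNIV_I UNIV_I] ideal_equiv_iff[OF I]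
  have bot_I: "bot \<in> I" using I by (simp add: ba_ideal_def)
  let ?s = "Restr ?Q C'"
  have s_eq: "?s = Restr (Restr ?Q C) C'" using C' by blast
  have W: "Well_order ?s"
    unfolding s_eq using well_order_on_Well_order[OF C(2)] Well_order_Restr by blast
  have "(X, X) \<in> ?Q" if "X \<in> C" for X
    using C(2) that by (auto simp: order_on_defs refl_on_def)
  then have Fs: "Field ?s = C'" unfolding Field_def using C' by blast
  have lin: "Linear_order ?s" using W by (simp add: well_order_on_def)
  have "\<exists>a. X = ideal_equiv I `` {a}" if "X \<in> C'" for X
  proof -
    have "X \<in> Field ?Q" using that C(1) C' by blast
    then show ?thesis unfolding Field_def quotient_order_def by blast
  qed
  then obtain rep where rep: "\<And>X. X \<in> C' \<Longrightarrow> ideal_equiv I `` {rep X} = X" by metis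
  have ord: "(X, Y) \<in> ?Q \<longleftrightarrow> rep X - rep Y \<in> I" if "X \<in> C'" "Y \<in> C'" for X Y
    using quotient_order_iff[OF I, of "rep X" "rep Y"] rep that by simp
  have "free_sequence ?s (\<lambda>X. - rep X)"
    unfolding free_sequence_def Fs
  proof (intro conjI allI impI)
    show "well_order_on C' ?s" using W Fs by simp
    fix F G
    assume *: "finite F \<and> finite G \<and> F \<subseteq> C' \<and> G \<subseteq> C' \<and> (\<forall>\<alpha>\<in>F. \<forall>\<beta>\<in>G. (\<alpha>, \<beta>) \<in> ?s \<and> \<alpha> \<noteq> \<beta>)"
    \<comment> \<open>\<open>p\<close> represents the greatest class in \<open>F\<close> and
      \<open>q\<close> below the least class in \<open>G\<close>. The defaults \<open>bot\<close>
      and \<open>top\<close> reduce \<open>q - p\<close> to \<open>q\<close> or \<open>- p\<close>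
      when one set is empty.\<close>
    obtain p where p: "\<And>X. X \<in> F \<Longrightarrow> rep X - p \<in> I" "p = bot \<and> F = {} \<or> (\<exists>X\<in>F. p = rep X)"
    proof (cases "F = {}")
      case False
      then obtain m where "m \<in> F" "\<forall>x\<in>F. (x, m) \<in> ?s"
        using Linear_order_finite_max[OF lin, of F] * Fs by blast
      then show thesis using that[of "rep m"] ord * by blast
    qed (use that in simp)
    obtain q where q: "\<And>Y. Y \<in> G \<Longrightarrow> q - rep Y \<in> I" "q = top \<and> G = {} \<or> (\<exists>Y\<in>G. q = rep Y)"
    proof (cases "G = {}")
      case False
      have "Linear_order (?s\<inverse>)" using lin by simp
      from Linear_order_finite_max[OF this, of G] obtain m where "m \<in> G" "\<forall>x\<in>G. (m, x) \<in> ?s"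
        using * Fs False by auto
      then show thesis using that[of "rep m"] ord * by blast
    qed (use that in simp)
    have nb: "rep X \<notin> I" "- rep X \<notin> I" if "X \<in> C'" for X
    proof -
      have "X \<noteq> ideal_equiv I `` {bot}" "X \<noteq> ideal_equiv I `` {top}" using that C' by blast+
      then show "rep X \<notin> I" "- rep X \<notin> I"
        using rep[OF that] eq(1)[of "rep X" bot] eq(1)[of "rep X" top] eq(2) bot_I
        by (auto simp: diff_eq)
    qed
    show "meet ((\<lambda>X. - rep X) ` F \<union> (\<lambda>\<beta>. - (- rep \<beta>)) ` G) \<noteq> bot"
    proof (cases "F = {} \<and> G = {}")
      case True
      then show ?thesis using nontriv by simp
    next
      case False
      \<comment> \<open>If one of the sets is empty, this is where the removal of the classes of
        \<open>bot\<close> and \<open>top\<close> from the chain enters.\<close>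
      have "q - p \<notin> I"
      proof (cases "F = {} \<or> G = {}")
        case True
        then show ?thesis using False p(2) q(2) nb * by (auto simp: diff_eq)
      next
        case False
        then obtain X Y where XY: "X \<in> F" "Y \<in> G" "p = rep X" "q = rep Y" using p(2) q(2) by blast
        then have "(Y, X) \<notin> ?s"
          using * lin unfolding order_on_defs antisym_def by blast
        then show ?thesis using XY * ord by blast
      qed
      \<comment> \<open>Membership in an ultrafilter disjoint from \<open>I\<close> is monotone
        modulo \<open>I\<close>, so \<open>q - p\<close> alone decides all representatives from
        \<open>F\<close> and \<open>G\<close>.\<close>
      then obtain U where U: "ultrafilter U" "q - p \<in> U" "U \<inter> I = {}"
        using ultrafilter_exists_avoiding[OF I] by blast
      have "rep X \<notin> U" if "X \<in> F" for X
        using ultrafilter_ideal_equivD[OF U(1,3) I p(1)[OF that]] U(1,2) by auto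
      moreover have "rep Y \<in> U" if "Y \<in> G" for Y
        using ultrafilter_ideal_equivD[OF U(1,3) I q(1)[OF that]] U(1,2) by auto
      ultimately have "(\<lambda>X. - rep X) ` F \<union> (\<lambda>\<beta>. - (- rep \<beta>)) ` G \<subseteq> U" using U(1) by auto
      then have "meet ((\<lambda>X. - rep X) ` F \<union> (\<lambda>\<beta>. - (- rep \<beta>)) ` G) \<in> U"
        using meet_in_ultrafilter[OF U(1), of "(\<lambda>X. - rep X) ` F \<union> (\<lambda>\<beta>. - (- rep \<beta>)) ` G"] * by simp
      then show ?thesis using U(1) ultrafilter_bot by metis
    qed
  qed
  with Fs show ?thesis by blast
qed

lemma Card_order_tightness: "Card_order (tightness :: 'a::boolean_algebra rel)"
  unfolding tightness_def by (rule card_Sup(1)) (auto intro: card_of_Card_order)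

lemma Card_order_Depth: "Card_order (Depth Q)"
  unfolding Depth_def by (rule card_Sup(1)) (auto intro: card_of_Card_order)

text \<open>Without the classes of \<open>bot\<close> and \<open>top\<close> a chain has the size of
  a free sequence; an infinite \<open>tightness\<close> absorbs these two classes.\<close>

lemma Depth_le_tightness:
  fixes I :: "'a::boolean_algebra set"
  assumes I: "ba_ideal I" and inf: "infinite (Field (tightness :: 'a rel))"
  shows "Depth (quotient_order I) \<le>o (tightness :: 'a rel)"
proof (rule Depth_leI[OF Card_order_tightness])
  let ?t = "tightness :: 'a rel"
  have t: "Cinfinite ?t" using inf Card_order_tightness by (simp add: cinfinite_def)
  have nontriv: "(bot :: 'a) \<noteq> top"
  proof
    assume "(bot :: 'a) = top"
    then have "x = bot" for x :: 'a by (metis inf_bot_right inf_top_right)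
    then have "Field ?t \<subseteq> {bot}" by blast
    with inf show False using finite_subset by blast
  qed
  fix C assume C: "C \<subseteq> Field (quotient_order I)" "well_order_on C (Restr (quotient_order I) C)"
  let ?N = "{ideal_equiv I `` {bot}, ideal_equiv I `` {top}}"
  obtain s :: "'a set rel" and b :: "'a set \<Rightarrow> 'a" where "free_sequence s b" "Field s = C - ?N"
    using quotient_chain_free_sequence[OF I nontriv C refl] by blast
  then have "|C - ?N| \<le>o ?t" using free_sequence_le_tightness by metis
  moreover have "|?N| \<le>o ?t"
    using Cfinite_ordLess_Cinfinite[of "|?N|" ?t] t
    by (simp add: cfinite_def Field_card_of card_of_card_order_on ordLess_imp_ordLeq)
  ultimately have "|(C - ?N) \<union> ?N| \<le>o ?t" using t by (rule Un_Cinfinite_bound)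
  moreover have "|C| \<le>o |(C - ?N) \<union> ?N|" by (rule card_of_mono1) blast
  ultimately show "|C| \<le>o ?t" using ordLeq_transitive by blast
qed

section \<open>The attained case\<close>

lemma finite_card_of_ordLeq_iff:
  "finite A \<Longrightarrow> finite B \<Longrightarrow> |A| \<le>o |B| \<longleftrightarrow> card A \<le> card B"
  by (simp add: card_of_ordLeq[symmetric] inj_on_iff_card_le)

text \<open>The points of the sequence make the complements \<open>- b x\<close> a strictly
  increasing chain. Conversely, infinite chains are bounded by the general estimate, while for a
  finite sequence chains in the quotient are counted as chains of subsets of a finite set of
  points.\<close>

lemma tightness_attained_ideal:
  fixes b :: "'i \<Rightarrow> 'a::boolean_algebra"
  assumes free: "free_sequence r b" and r: "|Field r| =o (tightness :: 'a rel)"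
    and ne: "Field r \<noteq> {}"
  shows "\<exists>I :: 'a set. ba_ideal I \<and> Depth (quotient_order I) =o (tightness :: 'a rel)"
proof -
  let ?t = "tightness :: 'a rel"
  have W: "Well_order r" using free by (simp add: free_sequence_def)
  then have lin: "Linear_order r" by (simp add: well_order_on_def)
  obtain X where X: "\<And>x. x \<in> Field r \<Longrightarrow> ultrafilter (X x)"
    and bX: "\<And>x y. x \<in> Field r \<Longrightarrow> y \<in> Field r \<Longrightarrow> b y \<in> X x \<longleftrightarrow> (y, x) \<in> r"
    using free_sequence_ultrafilter[OF free] by metis
  \<comment> \<open>The last point of a finite sequence is left out, since a chain of \<open>n\<close> elements in a
    quotient may contain its least and greatest element and then separates only \<open>n - 1\<close> points.\<close>
  define N where "N = {x \<in> Field r. \<exists>y. (x, y) \<in> r \<and> x \<noteq> y}"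
  let ?I = "null_ideal (X ` N)"
  have N: "N \<subseteq> Field r" by (auto simp: N_def)
  have Y: "\<forall>U\<in>X ` N. ultrafilter U" using X N by blast
  note I = ba_ideal_null_ideal[OF Y]
  have "|Field r| \<le>o Depth (quotient_order ?I)"
  proof (rule chain_le_Depth[OF Y W subset_refl, of "\<lambda>x. - b x"])
    fix x y assume xy: "x \<in> Field r" "y \<in> Field r" "(x, y) \<in> r" "x \<noteq> y"
    show "- b y \<in> U" if U: "U \<in> X ` N" "- b x \<in> U" for U
    proof -
      obtain z where z: "U = X z" "z \<in> Field r" using U N by blast
      have "(x, z) \<in> r" if "(y, z) \<in> r"
        using that xy(3) lin unfolding order_on_defs trans_def by blast
      then show ?thesis using z bX X xy U(2) by auto
    qed
    have "(y, x) \<notin> r" "(x, x) \<in> r"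
      using xy lin unfolding order_on_defs antisym_def refl_on_def by blast+
    then have "- b y \<in> X x" "- b x \<notin> X x" using bX X xy by auto
    moreover have "X x \<in> X ` N" unfolding N_def using xy by blast
    ultimately show "\<exists>U\<in>X ` N. - b y \<in> U \<and> - b x \<notin> U" by blast
  qed
  then have lower: "?t \<le>o Depth (quotient_order ?I)"
    using r ordIso_symmetric ordIso_ordLeq_trans by blast
  have "Depth (quotient_order ?I) \<le>o ?t"
  proof (cases "finite (Field r)")
    case False
    then have "infinite (Field ?t)"
      using card_of_ordIso_finite_Field[OF Card_order_tightness ordIso_symmetric[OF r]] by blast
    then show ?thesis by (rule Depth_le_tightness[OF I])
  next
    case fin: True
    obtain m where m: "m \<in> Field r" "\<forall>x\<in>Field r. (x, m) \<in> r"
      using Linear_order_finite_max[OF lin fin ne] by blast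
    have "m \<notin> N"
      using m(2) lin unfolding N_def order_on_defs antisym_def by (auto intro: FieldI2)
    then have "card N < card (Field r)" using N m(1) fin by (metis psubset_card_mono psubsetI)
    have finN: "finite N" using N fin by (rule finite_subset)
    show ?thesis
    proof (rule Depth_leI[OF Card_order_tightness])
      fix C assume C: "C \<subseteq> Field (quotient_order ?I)"
        "well_order_on C (Restr (quotient_order ?I) C)"
      have "\<exists>a. Z = ideal_equiv ?I `` {a}" if "Z \<in> C" for Z
        using that C(1) unfolding Field_def quotient_order_def by blast
      then obtain rep where rep: "\<And>Z. Z \<in> C \<Longrightarrow> ideal_equiv ?I `` {rep Z} = Z" by metis
      define h where "h Z = {x \<in> N. rep Z \<in> X x}" for Z
      have hN: "h Z \<subseteq> N" for Z by (auto simp: h_def)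
      have h: "(Z, Z') \<in> quotient_order ?I \<longleftrightarrow> h Z \<subseteq> h Z'" if "Z \<in> C" "Z' \<in> C" for Z Z'
      proof -
        have "(Z, Z') \<in> quotient_order ?I \<longleftrightarrow> rep Z - rep Z' \<in> ?I"
          using quotient_order_iff[OF I, of "rep Z" "rep Z'"] rep that by simp
        also have "\<dots> \<longleftrightarrow> h Z \<subseteq> h Z'"
          unfolding diff_in_null_ideal[OF Y] h_def by blast
        finally show ?thesis .
      qed
      \<comment> \<open>The traces \<open>h Z\<close> form a chain of subsets of \<open>N\<close>,
        so their sizes are distinct numbers up to \<open>card N\<close>. That allows
        \<open>card N + 1\<close> values, at most \<open>card (Field r)\<close> since
        \<open>m\<close> is not in \<open>N\<close>.\<close>
      have "inj_on (\<lambda>Z. card (h Z)) C"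
      proof (rule inj_onI)
        fix Z Z' assume Z: "Z \<in> C" "Z' \<in> C" "card (h Z) = card (h Z')"
        have "h Z \<subseteq> h Z' \<or> h Z' \<subseteq> h Z"
        proof (cases "Z = Z'")
          case False
          have "total_on C (Restr (quotient_order ?I) C)" using C(2) by (simp add: order_on_defs)
          then have "(Z, Z') \<in> quotient_order ?I \<or> (Z', Z) \<in> quotient_order ?I"
            using Z(1,2) False unfolding total_on_def by blast
          then show ?thesis using h[OF Z(1,2)] h[OF Z(2,1)] by blast
        qed simp
        then have "h Z = h Z'"
          using Z(3) hN finN by (metis card_subset_eq finite_subset)
        then have "(Z, Z') \<in> Restr (quotient_order ?I) C" "(Z', Z) \<in> Restr (quotient_order ?I) C"
          using h[OF Z(1,2)] h[OF Z(2,1)] Z(1,2) by simp_all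
        moreover have "antisym (Restr (quotient_order ?I) C)" using C(2) by (simp add: order_on_defs)
        ultimately show "Z = Z'" by (simp only: antisymD)
      qed
      moreover have "(\<lambda>Z. card (h Z)) ` C \<subseteq> {..card N}"
        using hN finN by (auto intro: card_mono)
      ultimately have "finite C" "card C \<le> card {..card N}"
        by (rule inj_on_finite[OF _ _ finite_atMost], rule card_inj_on_le[OF _ _ finite_atMost])
      then have "|C| \<le>o |Field r|"
        using \<open>card N < card (Field r)\<close> fin by (simp add: finite_card_of_ordLeq_iff)
      then show "|C| \<le>o ?t" using r by (rule ordLeq_ordIso_trans)
    qed
  qed
  with lower I show ?thesis using ordIso_iff_ordLeq by blast
qed

section \<open>The unattained case\<close>

text \<open>Otherwise \<open>|A|\<close> would bound all lengths and hence their supremum; the copy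
  \<open>B\<close> of \<open>A\<close> puts this bound on the type over which
  \<open>card_Sup\<close> is minimal.\<close>

lemma free_sequence_of_card_less_tightness:
  fixes A :: "'x set"
  assumes "|A| <o (tightness :: 'a::boolean_algebra rel)"
  shows "\<exists>(r :: 'a rel) (b :: 'a \<Rightarrow> 'a). free_sequence r b \<and> |A| <o |Field r|"
proof (rule ccontr)
  let ?t = "tightness :: 'a rel"
  assume contr: "\<nexists>(r :: 'a rel) (b :: 'a \<Rightarrow> 'a). free_sequence r b \<and> |A| <o |Field r|"
  obtain B :: "'a set" where B: "|A| =o |B|"
    using internalize_card_of_ordLeq[of A ?t] assms ordLess_imp_ordLeq by blast
  have "|Field r| \<le>o |B|" if "free_sequence r b" for r :: "'a rel" and b :: "'a \<Rightarrow> 'a"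
  proof -
    have "\<not> |A| <o |Field r|" using contr that by blast
    then have "|Field r| \<le>o |A|"
      by (simp only: not_ordLess_iff_ordLeq[OF card_of_Well_order card_of_Well_order])
    then show ?thesis using B by (rule ordLeq_ordIso_trans)
  qed
  then have "?t \<le>o |B|"
    unfolding tightness_def by (intro card_Sup(3)) (auto intro: card_of_Card_order)
  then have "?t \<le>o |A|" using B ordIso_symmetric ordLeq_ordIso_trans by blast
  with assms show False using not_ordLess_ordLeq by blast
qed

lemma tightness_unattained_ideal:
  assumes less: "ctwo ^c cofinality (tightness :: 'a::boolean_algebra rel) <o (tightness :: 'a rel)"
    and unattained: "\<And>(r :: 'a rel) (b :: 'a \<Rightarrow> 'a). free_sequence r b \<Longrightarrow> |Field r| <o (tightness :: 'a rel)"
  shows "\<exists>I :: 'a set. ba_ideal I \<and> Depth (quotient_order I) =o (tightness :: 'a rel)"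
proof -
  let ?t = "tightness :: 'a rel"
  note t = Card_order_tightness[where 'a = 'a]
  have Wt: "Well_order ?t" using t card_order_on_well_order_on by blast
  have ne: "Field ?t \<noteq> {}"
    using less by (metis Card_order_empty Card_order_cexp card_of_Field_ordIso not_ordLess_ordLeq
        ordIso_symmetric ordIso_ordLeq_trans t card_of_empty)
  \<comment> \<open>A finite nonzero supremum is attained: a length above its predecessor can only
    be the supremum itself.\<close>
  have inf: "infinite (Field ?t)"
  proof
    assume fin: "finite (Field ?t)"
    obtain x where x: "x \<in> Field ?t" using ne by blast
    let ?A = "Field ?t - {x}"
    have cA: "card ?A < card (Field ?t)" using fin x by (rule card_Diff1_less)
    have Ft: "|Field ?t| =o ?t" by (rule card_of_Field_ordIso[OF t])
    have "\<not> |Field ?t| \<le>o |?A|" using cA fin by (simp add: finite_card_of_ordLeq_iff)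
    then have "|?A| <o |Field ?t|"
      by (simp only: not_ordLeq_iff_ordLess[OF card_of_Well_order card_of_Well_order])
    then have "|?A| <o ?t" using Ft by (rule ordLess_ordIso_trans)
    from free_sequence_of_card_less_tightness[OF this]
    obtain r :: "'a rel" and b :: "'a \<Rightarrow> 'a" where r: "free_sequence r b" "|?A| <o |Field r|" by blast
    have "|Field r| <o |Field ?t|"
      using unattained[OF r(1)] ordIso_symmetric[OF Ft] by (rule ordLess_ordIso_trans)
    moreover from this have "finite (Field r)"
      using fin card_of_ordLeq_finite ordLess_imp_ordLeq by blast
    ultimately have "card (Field r) < card (Field ?t)" "card ?A < card (Field r)"
      using r(2) fin not_ordLess_ordLeq
      by (metis finite_card_of_ordLeq_iff not_le finite_Diff)+
    then show False using cA x fin by (simp add: card_Diff_singleton)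
  qed
  have tinf: "Cinfinite ?t" using t inf by (simp add: cinfinite_def)
  \<comment> \<open>\<open>tightness\<close> is a limit cardinal: some length exceeds
    \<open>p\<close>, so it is at least \<open>cardSuc p\<close>, and no length reaches
    \<open>tightness\<close>.\<close>
  have cardSuc_less: "cardSuc p <o ?t" if "Card_order p" "p <o ?t" for p :: "'p rel"
  proof -
    have p: "|Field p| =o p" by (rule card_of_Field_ordIso[OF that(1)])
    then have "|Field p| <o ?t" using that(2) by (rule ordIso_ordLess_trans)
    from free_sequence_of_card_less_tightness[OF this]
    obtain r :: "'a rel" and b :: "'a \<Rightarrow> 'a" where r: "free_sequence r b" "|Field p| <o |Field r|" by blast
    have "p <o |Field r|" using ordIso_symmetric[OF p] r(2) by (rule ordIso_ordLess_trans)
    then have "cardSuc p \<le>o |Field r|" using that(1) card_of_Card_order by (intro cardSuc_least)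
    then show ?thesis using unattained[OF r(1)] by (rule ordLeq_ordLess_trans)
  qed
  obtain K where K: "K \<subseteq> Field ?t" "\<And>a. a \<in> Field ?t \<Longrightarrow> \<exists>k\<in>K. (a, k) \<in> ?t"
      "cofinality ?t = |K|"
    using cofinality(1)[OF Wt] unfolding unbounded_in_def by blast
  \<comment> \<open>The greatest element of a finite unbounded \<open>K\<close> would be greatest in
    \<open>?t\<close>, but an infinite cardinal has none.\<close>
  have infK: "infinite K"
  proof
    assume "finite K"
    moreover have "K \<noteq> {}" using K(2) ne by blast
    ultimately obtain m where m: "m \<in> K" "\<forall>k\<in>K. (k, m) \<in> ?t"
      using Linear_order_finite_max[of ?t K] K(1) Wt unfolding well_order_on_def by blast
    obtain x where x: "x \<in> Field ?t" "m \<noteq> x" "(m, x) \<in> ?t"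
      using infinite_Card_order_limit[OF t inf, of m] m K(1) by blast
    then obtain k where "k \<in> K" "(x, k) \<in> ?t" using K(2) by blast
    then have "(x, m) \<in> ?t"
      using m(2) Wt unfolding order_on_defs trans_def by blast
    then show False using x Wt unfolding order_on_defs antisym_def by blast
  qed
  \<comment> \<open>\<open>?r\<close> bounds the number of traces in the pigeonhole argument,
    \<open>?s\<close> the size of the closed set, and \<open>?c\<close> is one cardinal larger so
    that some block lies outside that set.\<close>
  let ?r = "|Pow K|" and ?s = "cardSuc |Pow K|"
  let ?c = "cardSuc ?s"
  have r: "Cinfinite ?r" using infK by (simp add: cinfinite_def Field_card_of card_of_card_order_on)
  have s: "Cinfinite ?s" using r by (rule Cinfinite_cardSuc)
  have c: "Cinfinite ?c" using s by (rule Cinfinite_cardSuc)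
  have Kinf: "Cinfinite |K|" using infK by (simp add: cinfinite_def Field_card_of card_of_card_order_on)
  have pow: "|Pow K| =o ctwo ^c |K|"
    using card_of_Pow_Func[of K] by (simp add: cexp_def ctwo_def Field_card_of)
  have rt: "?r <o ?t" using pow less unfolding K(3) by (rule ordIso_ordLess_trans)
  have st: "?s <o ?t" using r by (intro cardSuc_less rt) auto
  have ct: "?c <o ?t" using s by (intro cardSuc_less st) auto
  have Kr: "|K| \<le>o ?r" using card_of_Pow ordLess_imp_ordLeq by blast
  have Ks: "|K| \<le>o ?s" using ordLeq_transitive[OF Kr cardSuc_ordLeq] r by blast
  \<comment> \<open>Here 2^|K| raised to |K| is again 2^|K|; two uses of the Hausdorff formula then
    carry this bound to \<open>?s\<close> and \<open>?c\<close>.\<close>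
  have "|Func K (Pow K)| \<le>o ?r"
  proof -
    have "?r ^c |K| =o (ctwo ^c |K| ) ^c |K|"
      using pow card_of_Card_order by (rule cexp_cong1)
    also have "(ctwo ^c |K| ) ^c |K| =o ctwo ^c |K|"
      using Kinf by (intro cexp_cprod_ordLeq Card_order_ctwo Cinfinite_Cnotzero ordLeq_refl) auto
    also have "ctwo ^c |K| =o ?r" using pow by (rule ordIso_symmetric)
    finally show ?thesis by (simp add: cexp_def Field_card_of ordIso_imp_ordLeq)
  qed
  then have Fs: "|Func K (Field ?s)| \<le>o ?s"
    using Hausdorff_formula[OF r Kr] by (simp add: Field_card_of)
  have Fc: "|Func K (Field ?c)| \<le>o ?c" by (rule Hausdorff_formula[OF s Ks Fs])
  have cF: "?c =o |Field ?c|" using card_of_Field_ordIso c ordIso_symmetric by blast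
  have FcFc: "|Func K (Field ?c \<times> Field ?c)| \<le>o |Field ?c|"
    using card_of_Func_Times_ordLeq[OF c Fc ordLeq_card_of_Field(2)] c cF ordLeq_ordIso_trans by blast
  have sc: "?s <o |Field ?c|" using ordLess_ordIso_trans[OF cardSuc_greater cF] s by blast
  have Wc: "Well_order ?c" using c card_order_on_well_order_on by blast
  have Fct: "|Field ?c| <o ?t" using ordIso_ordLess_trans[OF ordIso_symmetric[OF cF] ct] .
  \<comment> \<open>The summand \<open>Field ?c\<close> makes the threshold at least the number of
    interval choices; \<open>underS ?t j\<close> makes the thresholds unbounded below
    \<open>?t\<close>. Their successors \<open>w j\<close> stay below \<open>?t\<close>, a limit
    cardinal.\<close>
  define V where "V j = Field ?c <+> underS ?t j" for j
  have Vt: "|V j| <o ?t" if "j \<in> K" for j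
    unfolding V_def using inf t Fct card_of_underS[OF t] that K(1)
    by (intro card_of_Plus_ordLess_infinite_Field) auto
  have cV: "|Field ?c| \<le>o |V j|" for j unfolding V_def by (rule card_of_Plus1)
  have Vinf: "infinite (V j)" for j
    using card_of_ordLeq_infinite[OF cV] c by (simp add: cinfinite_def)
  define w where "w j = cardSuc |V j|" for j
  have w: "Card_order (w j)" for j unfolding w_def by (rule cardSuc_Card_order[OF card_of_Card_order])
  then have Ww: "Well_order (w j)" for j using card_order_on_well_order_on by blast
  have wF: "w j =o |Field (w j)|" for j using card_of_Field_ordIso[OF w] by (rule ordIso_symmetric)
  have Vw: "|V j| <o |Field (w j)|" for j
    using cardSuc_greater[OF card_of_Card_order] wF unfolding w_def by (rule ordLess_ordIso_trans)
  have "\<exists>b :: _ \<Rightarrow> 'a. free_sequence (lex_order ?c (w j)) b" if j: "j \<in> K" for j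
  proof -
    have "|Field ?c| \<le>o |Field (w j)|"
      using ordLeq_ordLess_trans[OF cV Vw] by (rule ordLess_imp_ordLeq)
    moreover have "infinite (Field (w j))"
      using card_of_ordLeq_infinite[OF ordLess_imp_ordLeq[OF Vw] Vinf] .
    moreover have "Field ?c \<noteq> {}" using Field_cardSuc_not_empty s by blast
    ultimately have "|Field ?c \<times> Field (w j)| =o |Field (w j)|"
      using card_of_Times_infinite by blast
    \<comment> \<open>The factor \<open>?c\<close> does not raise the cardinality, so some free
      sequence is longer than the lexicographic product.\<close>
    then have "|Field ?c \<times> Field (w j)| =o w j"
      using ordIso_transitive ordIso_symmetric[OF wF] by blast
    moreover have "w j <o ?t" unfolding w_def using Vt[OF j] card_of_Card_order by (intro cardSuc_less)
    ultimately have "|Field (lex_order ?c (w j))| <o ?t"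
      unfolding Field_lex_order[OF Wc Ww] by (rule ordIso_ordLess_trans)
    from free_sequence_of_card_less_tightness[OF this] show ?thesis
      using free_sequence_of_order Well_order_lex_order[OF Wc Ww] by blast
  qed
  then obtain b where b: "\<And>j. j \<in> K \<Longrightarrow> free_sequence (lex_order ?c (w j)) (b j :: _ \<Rightarrow> 'a)" by metis
  have "\<exists>I :: 'a set. ba_ideal I \<and> (\<forall>j\<in>K. |V j| <o Depth (quotient_order I))"
    by (rule ideal_of_free_sequences[OF r ordLeq_refl[OF card_of_Card_order] Fs Wc sc FcFc])
      (use Vinf cV Ww Vw b in auto)
  then obtain I :: "'a set" where I: "ba_ideal I" "\<And>j. j \<in> K \<Longrightarrow> |V j| <o Depth (quotient_order I)"
    by blast
  let ?D = "Depth (quotient_order I)"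
  have D: "Card_order ?D" by (rule Card_order_Depth)
  then have WD: "Well_order ?D" using card_order_on_well_order_on by blast
  \<comment> \<open>If \<open>?D\<close> were smaller, it would be an initial segment of
    \<open>?t\<close> below some \<open>a\<close>; with \<open>j\<close> in \<open>K\<close> above
    \<open>a\<close> this gives \<open>?D \<le>o |V j|\<close>, against the choice of
    \<open>I\<close>.\<close>
  have "\<not> ?D <o ?t"
  proof
    assume "?D <o ?t"
    then obtain a where a: "a \<in> Field ?t" "?D =o Restr ?t (underS ?t a)"
      using ordLess_iff_ordIso_Restr[OF Wt WD] by blast
    obtain j where j: "j \<in> K" "(a, j) \<in> ?t" using K(2)[OF a(1)] by blast
    have "underS ?t a \<subseteq> underS ?t j"
      using Well_order_underS_mono[OF Wt] j(2) by (simp add: relChain_def)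
    with Field_Restr_subset have "Field (Restr ?t (underS ?t a)) \<subseteq> underS ?t j" by (rule subset_trans)
    then have "|Field (Restr ?t (underS ?t a))| \<le>o |underS ?t j|" by (rule card_of_mono1)
    then have "|Field ?D| \<le>o |underS ?t j|"
      by (rule ordIso_ordLeq_trans[OF card_of_cong[OF a(2)]])
    also have "|underS ?t j| \<le>o |V j|" unfolding V_def by (rule card_of_Plus2)
    finally have "?D \<le>o |V j|"
      using ordIso_ordLeq_trans[OF ordIso_symmetric[OF card_of_Field_ordIso[OF D]]] by blast
    with I(2)[OF j(1)] show False using not_ordLess_ordLeq by blast
  qed
  then have "?t \<le>o ?D" using ordLess_or_ordLeq[OF WD Wt] by blast
  with Depth_le_tightness[OF I(1) inf] I(1) show ?thesis using ordIso_iff_ordLeq by blast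
qed

theorem theorem6p7:
  assumes "ctwo ^c cofinality (tightness :: 'a::boolean_algebra rel) <o (tightness :: 'a rel)"
  shows "\<exists>I :: 'a set. ba_ideal I \<and> Depth (quotient_order I) =o (tightness :: 'a rel)"
proof (cases "\<exists>(r :: 'a rel) (b :: 'a \<Rightarrow> 'a). free_sequence r b \<and> |Field r| =o (tightness :: 'a rel)")
  case True
  then obtain r :: "'a rel" and b :: "'a \<Rightarrow> 'a"
    where r: "free_sequence r b" "|Field r| =o (tightness :: 'a rel)" by blast
  have "Field r \<noteq> {}"
  proof
    assume "Field r = {}"
    with r(2) have "|{} :: 'a set| =o (tightness :: 'a rel)" by simp
    from ordIso_ordLeq_trans[OF ordIso_symmetric[OF this] Card_order_empty[OF Card_order_cexp]]
    have "(tightness :: 'a rel) \<le>o ctwo ^c cofinality (tightness :: 'a rel)" .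
    then show False using assms not_ordLess_ordLeq by blast
  qed
  then show ?thesis by (rule tightness_attained_ideal[OF r])
next
  case False
  have "|Field r| <o (tightness :: 'a rel)" if "free_sequence r b" for r :: "'a rel" and b :: "'a \<Rightarrow> 'a"
    using free_sequence_le_tightness[OF that] False that ordLeq_iff_ordLess_or_ordIso by blast
  with assms show ?thesis by (rule tightness_unattained_ideal)
qed

end
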